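(* Let $n,k\ge 0$ be integers with $n+k\ge 1$, and let $A_{n,k}=C_{n+1}\oplus A_k$ be the ordinal sum of a chain with $n+1$ elements and an antichain with $k$ elements. Let $h=(h_0,h_1,\ldots,h_{n+k-1})$ be the $h$-vector of the poset associahedron $\mathscr{A}(A_{n,k})$. Then for every $i$ with $0\le i\le n+k-1$, $h_i$ equals the number of permutations in $s^{-1}(\mathfrak{S}_{n,k})$ with exactly $i$ descents, where $s$ is the stack-sorting map on $\mathfrak{S}_{n+k}$ and $\mathfrak{S}_{n,k}=\{w\in\mathfrak{S}_{n+k} : w_i=i \text{ for all } i>k\}$.
   Context: Posets. $C_m$ is the chain with $m$ elements and $A_k$ the antichain with $k$ elements. The ordinal sum $P\oplus Q$ has underlying set $P\sqcup Q$, with $a\le b$ iff ($a,b\in P$ and $a\le_P b$) or ($a,b\in Q$ and $a\le_Q b$) or ($a\in P$ and $b\in Q$). Poset associahedron. Let $(P,\preceq)$ be a finite connected poset. A subset $\tau\subseteq P$ is connected if it is connected as an induced subgraph of the Hasse diagram of $P$; it is convex if $x,z\in\tau$, $y\in P$, $x\preceq y\preceq z$ imply $y\in\tau$. A tube is a connected convex subset; it is proper if $1<|\tau|<|P|$. Two tubes are nested if one contains the other, and disjoint if their intersection is empty. Write $\sigma\prec\tau$ if $\sigma\cap\tau=\emptyset$ and there are $x\in\sigma$, $y\in\tau$ with $x\preceq y$. A tubing is a set $T$ of proper tubes, any two of which are nested or disjoint, such that there is no subset $\{\tau_1,\ldots,\tau_m\}\subseteq T$ with $\tau_1\prec\tau_2\prec\cdots\prec\tau_m\prec\tau_1$.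 The poset associahedron $\mathscr{A}(P)$ is a simple convex polytope of dimension $|P|-2$ (it exists by a theorem of Galashin) whose face lattice is the set of tubings of $P$ ordered by reverse inclusion; a tubing with $j$ tubes corresponds to a face of dimension $|P|-2-j$. Face numbers. For a $d$-dimensional simple polytope with $f_i$ faces of dimension $i$ ($0\le i\le d$), the $f$-polynomial is $f(t)=\sum_{i=0}^d f_it^i$, and the $h$-vector $(h_0,\ldots,h_d)$ and $h$-polynomial $h(t)=\sum_{i=0}^d h_it^i$ are defined by $f(t)=h(t+1)$. Stack-sorting. $\mathfrak{S}_m$ is the set of permutations of $\{1,\ldots,m\}$ in one-line notation. The stack-sorting map $s:\mathfrak{S}_m\to\mathfrak{S}_m$ processes the entries of $\pi$ from left to right using an initially empty stack: for each next entry $x$, while the stack is nonempty and its top is smaller than $x$, pop the top to the end of the output; then push $x$. After all entries have been read, pop all remaining stack entries to the output. The output word is $s(\pi)$. Equivalently, $s$ of the empty word is empty and $s(LmR)=s(L)s(R)m$, where $m$ is the largest entry. A descent of $w$ is an index $i$ with $w_i>w_{i+1}$. $s^{-1}(A)$ denotes the preimage of the set $A$. *)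

theory Defs
  imports
    "HOL-Analysis.Analysis"
    "HOL-Computational_Algebra.Polynomial"
    "HOL-Combinatorics.Multiset_Permutations"
begin

section \<open>Posets\<close>

text \<open>
  A poset is given by its reflexive order relation \<^term>\<open>r\<close>, with \<^prop>\<open>(x, y) \<in> r\<close> meaning
  that \<open>x\<close> lies below or equals \<open>y\<close>. The underlying set is \<^term>\<open>Field r\<close>.
\<close>

definition chain_poset :: "nat \<Rightarrow> nat rel" where
  "chain_poset m = {(i, j). i \<le> j \<and> j < m}"

definition antichain_poset :: "nat \<Rightarrow> nat rel" where
  "antichain_poset k = Id_on {..<k}"

definition ordinal_sum :: "'a rel \<Rightarrow> 'b rel \<Rightarrow> ('a + 'b) rel" where
  "ordinal_sum p q =
     {(Inl a, Inl b) | a b. (a, b) \<in> p} \<union>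
     {(Inr a, Inr b) | a b. (a, b) \<in> q} \<union>
     {(Inl a, Inr b) | a b. a \<in> Field p \<and> b \<in> Field q}"

definition covers :: "'a rel \<Rightarrow> 'a rel" where
  "covers r = {(x, y) \<in> r. x \<noteq> y \<and> (\<forall>z. (x, z) \<in> r \<and> (z, y) \<in> r \<longrightarrow> z = x \<or> z = y)}"

definition hasse_diagram :: "'a rel \<Rightarrow> 'a rel" where
  "hasse_diagram r = covers r \<union> (covers r)\<inverse>"

definition hasse_connected :: "'a rel \<Rightarrow> 'a set \<Rightarrow> bool" where
  "hasse_connected r \<tau> \<longleftrightarrow> (\<forall>x\<in>\<tau>. \<forall>y\<in>\<tau>. (x, y) \<in> (hasse_diagram r \<inter> \<tau> \<times> \<tau>)\<^sup>*)"

definition order_convex :: "'a rel \<Rightarrow> 'a set \<Rightarrow> bool" where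
  "order_convex r \<tau> \<longleftrightarrow>
     (\<forall>x\<in>\<tau>. \<forall>z\<in>\<tau>. \<forall>y\<in>Field r. (x, y) \<in> r \<and> (y, z) \<in> r \<longrightarrow> y \<in> \<tau>)"

definition finite_connected_poset :: "'a rel \<Rightarrow> bool" where
  "finite_connected_poset r \<longleftrightarrow>
     Partial_order r \<and> finite (Field r) \<and> hasse_connected r (Field r)"


section \<open>Tubings\<close>

definition tube :: "'a rel \<Rightarrow> 'a set \<Rightarrow> bool" where
  "tube r \<tau> \<longleftrightarrow> \<tau> \<subseteq> Field r \<and> hasse_connected r \<tau> \<and> order_convex r \<tau>"

definition proper_tube :: "'a rel \<Rightarrow> 'a set \<Rightarrow> bool" where
  "proper_tube r \<tau> \<longleftrightarrow> tube r \<tau> \<and> 1 < card \<tau> \<and> card \<tau> < card (Field r)"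

definition tube_prec :: "'a rel \<Rightarrow> 'a set \<Rightarrow> 'a set \<Rightarrow> bool" where
  "tube_prec r \<sigma> \<tau> \<longleftrightarrow> \<sigma> \<inter> \<tau> = {} \<and> (\<exists>x\<in>\<sigma>. \<exists>y\<in>\<tau>. (x, y) \<in> r)"

definition tubing :: "'a rel \<Rightarrow> 'a set set \<Rightarrow> bool" where
  "tubing r T \<longleftrightarrow>
     (\<forall>\<tau>\<in>T. proper_tube r \<tau>) \<and>
     (\<forall>\<sigma>\<in>T. \<forall>\<tau>\<in>T. \<sigma> \<subseteq> \<tau> \<or> \<tau> \<subseteq> \<sigma> \<or> \<sigma> \<inter> \<tau> = {}) \<and>
     acyclic {(\<sigma>, \<tau>). \<sigma> \<in> T \<and> \<tau> \<in> T \<and> tube_prec r \<sigma> \<tau>}"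


section \<open>Poset associahedra\<close>

definition simple_polytope :: "'e::euclidean_space set \<Rightarrow> bool" where
  "simple_polytope Q \<longleftrightarrow>
     polytope Q \<and>
     (\<forall>v. v extreme_point_of Q \<longrightarrow> int (card {F. F facet_of Q \<and> v \<in> F}) = aff_dim Q)"

text \<open>
  The poset associahedron is determined only up to combinatorial equivalence, so it is rendered
  as a property of a polytope \<^term>\<open>Q\<close>. Tubings ordered by reverse inclusion correspond to the
  nonempty faces (the empty tubing to \<^term>\<open>Q\<close> itself); the empty face, which Isabelle's
  \<^term>\<open>F face_of Q\<close> admits, corresponds to no tubing.
\<close>

definition poset_associahedron :: "'a rel \<Rightarrow> 'e::euclidean_space set \<Rightarrow> bool" where
  "poset_associahedron r Q \<longleftrightarrow>
     finite_connected_poset r \<and>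
     simple_polytope Q \<and>
     aff_dim Q = int (card (Field r)) - 2 \<and>
     (\<exists>\<phi>. bij_betw \<phi> {T. tubing r T} {F. F face_of Q \<and> F \<noteq> {}} \<and>
        (\<forall>T T'. tubing r T \<and> tubing r T' \<longrightarrow> (\<phi> T \<subseteq> \<phi> T' \<longleftrightarrow> T' \<subseteq> T)) \<and>
        (\<forall>T. tubing r T \<longrightarrow> aff_dim (\<phi> T) = int (card (Field r)) - 2 - int (card T)))"


section \<open>Face numbers\<close>

definition f_polynomial :: "'e::euclidean_space set \<Rightarrow> int poly" where
  "f_polynomial Q =
     (\<Sum>i\<le>nat (aff_dim Q). monom (int (card {F. F face_of Q \<and> aff_dim F = int i})) i)"

text \<open>
  The defining relation \<open>f(t) = h(t + 1)\<close>, solved for \<open>h\<close>.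
\<close>

definition h_polynomial :: "'e::euclidean_space set \<Rightarrow> int poly" where
  "h_polynomial Q = pcompose (f_polynomial Q) [:-1, 1:]"

lemma h_polynomial_iff:
  "h = h_polynomial Q \<longleftrightarrow> f_polynomial Q = pcompose h [:1, 1:]"
proof -
  have "pcompose (pcompose p [:-1, 1:]) [:1, 1:] = p"
    and "pcompose (pcompose p [:1, 1:]) [:-1, 1:] = p" for p :: "int poly"
    by (simp_all add: pcompose_assoc [symmetric] pcompose_pCons pcompose_idR)
  then show ?thesis
    unfolding h_polynomial_def by metis
qed

definition h_vector :: "'e::euclidean_space set \<Rightarrow> nat \<Rightarrow> int" where
  "h_vector Q i = coeff (h_polynomial Q) i"


section \<open>Stack-sorting\<close>

text \<open>
  The first argument is the remaining input, the second the stack with its top at the head; the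
  result is the output still to be written.
\<close>

fun stack_sort_run :: "nat list \<Rightarrow> nat list \<Rightarrow> nat list" where
  "stack_sort_run [] st = st"
| "stack_sort_run (x # xs) [] = stack_sort_run xs [x]"
| "stack_sort_run (x # xs) (y # st) =
     (if y < x then y # stack_sort_run (x # xs) st else stack_sort_run xs (x # y # st))"

definition stack_sort :: "nat list \<Rightarrow> nat list" where
  "stack_sort w = stack_sort_run w []"

text \<open>
  Permutations of \<open>{1..m}\<close> in one-line notation are the lists in
  \<^term>\<open>permutations_of_set {1..m}\<close>. List positions start at 0, so the entry written \<open>w\<^sub>i\<close> in the
  literature is \<^term>\<open>w ! (i - 1)\<close>.
\<close>

definition perms_fixing_above :: "nat \<Rightarrow> nat \<Rightarrow> nat list set" where
  "perms_fixing_above n k =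
     {w \<in> permutations_of_set {1..n + k}. \<forall>i. k < i \<and> i \<le> n + k \<longrightarrow> w ! (i - 1) = i}"

definition stack_sort_preimage :: "nat \<Rightarrow> nat list set \<Rightarrow> nat list set" where
  "stack_sort_preimage m A = {w \<in> permutations_of_set {1..m}. stack_sort w \<in> A}"

definition num_descents :: "nat list \<Rightarrow> nat" where
  "num_descents w = card {i. Suc i < length w \<and> w ! i > w ! Suc i}"


section \<open>The posets under consideration\<close>

definition broom_poset :: "nat \<Rightarrow> nat \<Rightarrow> (nat + nat) rel" where
  "broom_poset n k = ordinal_sum (chain_poset (n + 1)) (antichain_poset k)"

lemma Field_chain_poset: "Field (chain_poset m) = {..<m}"
  by (auto simp: chain_poset_def Field_def)

lemma Field_antichain_poset: "Field (antichain_poset k) = {..<k}"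
  by (auto simp: antichain_poset_def Field_def)

lemma Field_ordinal_sum: "Field (ordinal_sum p q) = Field p <+> Field q"
  by (fastforce simp: ordinal_sum_def Field_def)

lemma Field_broom_poset: "Field (broom_poset n k) = {..<n + 1} <+> {..<k}"
  by (simp add: broom_poset_def Field_ordinal_sum Field_chain_poset Field_antichain_poset)

lemma card_Field_broom_poset: "card (Field (broom_poset n k)) = n + 1 + k"
  by (simp add: Field_broom_poset card_Plus)

lemma finite_connected_broom_poset: "finite_connected_poset (broom_poset n k)"
proof -
  let ?r = "broom_poset n k"
  let ?F = "Field ?r"
  let ?E = "hasse_diagram ?r \<inter> ?F \<times> ?F"
  have po: "Partial_order ?r"
    unfolding partial_order_on_def preorder_on_def
    by (auto simp: refl_on_def trans_def antisym_def Field_broom_poset)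
       (auto simp: broom_poset_def ordinal_sum_def chain_poset_def antichain_poset_def Field_def)
  have fin: "finite ?F"
    by (simp add: Field_broom_poset)
  have sym: "sym ?E"
    by (auto simp: sym_def hasse_diagram_def)
  have chain_edge: "(Inl i, Inl (Suc i)) \<in> ?E" if "Suc i < n + 1" for i
    using that unfolding hasse_diagram_def covers_def
    by (auto simp: Field_broom_poset)
       (auto simp: broom_poset_def ordinal_sum_def chain_poset_def antichain_poset_def Field_def)
  have leaf_edge: "(Inl n, Inr j) \<in> ?E" if "j < k" for j
    using that unfolding hasse_diagram_def covers_def
    by (auto simp: Field_broom_poset)
       (auto simp: broom_poset_def ordinal_sum_def chain_poset_def antichain_poset_def Field_def)
  have chain_reach: "(Inl 0, Inl i) \<in> ?E\<^sup>*" if "i < n + 1" for i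
    using that
  proof (induction i)
    case (Suc i)
    then show ?case
      using chain_edge [of i] by (meson Suc_lessD rtrancl.rtrancl_into_rtrancl)
  qed simp
  have reach: "(Inl 0, x) \<in> ?E\<^sup>*" if "x \<in> ?F" for x
    using that chain_reach leaf_edge chain_reach [of n]
    by (auto simp: Field_broom_poset intro: rtrancl_into_rtrancl)
  have "(x, y) \<in> ?E\<^sup>*" if "x \<in> ?F" "y \<in> ?F" for x y
    using reach [OF that(1)] reach [OF that(2)] sym_rtrancl [OF sym]
    by (meson rtrancl_trans symD)
  then show ?thesis
    using po fin by (simp add: finite_connected_poset_def hasse_connected_def)
qed

end

theory Submission
  imports Defs "HOL-Library.Sublist"
begin

text \<open>
  Put \<open>x = t - 1\<close> and \<open>d = n + k - 1\<close>. The faces are counted by tubings, so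
  the \<open>h\<close>-polynomial at \<open>t\<close> is \<open>\<Sum>x^(d - |T|)\<close> over the tubings \<open>T\<close>, and this has to equal
  \<open>\<Sum>t^des(w)\<close> over the preimages \<open>w\<close>. Each side has a natural recursion in \<open>(n, k)\<close>. The two
  recursions are different; a generating function shows that they have the same solution.

  Permutations. Since \<open>s(LmR) = s(L)s(R)m\<close> for the largest entry \<open>m\<close>, the condition that \<open>s(w)\<close> ends
  with the \<open>n\<close> largest entries in increasing order splits into conditions of the same kind on \<open>L\<close>
  and \<open>R\<close>: either \<open>R\<close> contains all remaining prescribed entries and \<open>L\<close> is arbitrary, or \<open>R\<close> consists
  of some of the largest prescribed entries only, sorted by \<open>s\<close>, and \<open>L\<close> has to end with the others.
  This recursion is taken as the definition of the number \<open>broom_h t n k\<close>; that it counts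
  descents is \<open>preimage_descents_eq_broom_h\<close>.

  Tubings. A tube with at least two elements meets the chain in an interval, and has leaves only if
  that interval reaches the top of the chain. Two disjoint ones are therefore ordered by their
  chain parts, the acyclicity condition is automatic, and tubings are the same as laminar families
  (\<open>tubing_broom_poset_iff\<close>). The largest tube of a family that contains the bottom of the chain cuts
  the family into a family inside that tube and one disjoint from it (\<open>laminar_sum_split_point\<close>),
  which gives the second recursion, \<open>laminar_sum_proper_subtubes_rec\<close>.

  Comparison. Let \<open>W = \<Sum>broom_h t n k z\<^sup>n u\<^sup>k / k!\<close>, let \<open>N\<close> be its part with \<open>k = 0\<close> and \<open>E\<close> its part
  with \<open>n = 0\<close>, the exponential generating function of the Eulerian polynomials, and let
  \<open>e = exp(xu)\<close>. The recursion of \<open>broom_h\<close> says \<open>W = E + z(W + t((N - 1)W + E(W - N)))\<close>, and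
  \<open>E(t - e) = x\<close> is Euler's formula. Eliminating \<open>E\<close> gives \<open>W(t - e - xtzN) = x(1 - xzN)\<close>
  (\<open>bgf_closed_form\<close>), and the coefficients of this equation are the recursion for tubings
  (\<open>broom_h_recurrence\<close>).
\<close>

unbundle no vec_syntax
unbundle fps_syntax


section \<open>The common recursion\<close>

lemma sum_Pow_by_card:
  assumes "finite A"
  shows "(\<Sum>B\<in>Pow A. g (card B)) = (\<Sum>b\<le>card A. real (card A choose b) * g b)"
proof -
  have "(\<Sum>B\<in>Pow A. g (card B)) = (\<Sum>b\<le>card A. \<Sum>B\<in>{B \<in> Pow A. card B = b}. g (card B))"
    using assms by (intro sum.group [symmetric]) (auto simp: card_mono)
  also have "\<dots> = (\<Sum>b\<le>card A. real (card A choose b) * g b)"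
  proof (intro sum.cong refl)
    fix b
    have "card {B \<in> Pow A. card B = b} = card A choose b"
      using n_subsets [OF assms, of b] by (simp add: Pow_def)
    then show "(\<Sum>B\<in>{B \<in> Pow A. card B = b}. g (card B)) = real (card A choose b) * g b"
      by simp
  qed
  finally show ?thesis .
qed

text \<open>
  The recursion for the preimages: \<open>n\<close> is the number of prescribed final entries and \<open>k\<close> the number of
  other entries. The equations split off the largest entry. In the first sum there are \<open>r\<close> prescribed
  entries and nothing else to its right; in the second sum all remaining prescribed entries and \<open>j\<close>
  of the others are to its right. With \<open>n = 0\<close> the numbers are the values of the
  Eulerian polynomials, and with \<open>k = 0\<close> those of the Narayana polynomials.
\<close>
function broom_h :: "real \<Rightarrow> nat \<Rightarrow> nat \<Rightarrow> real" where
  "broom_h t 0 0 = 1"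
| "broom_h t 0 (Suc k) =
     broom_h t 0 k + t * (\<Sum>j=1..k. real (k choose j) * broom_h t 0 (k - j) * broom_h t 0 j)"
| "broom_h t (Suc n) k =
     broom_h t n k + t * ((\<Sum>r=1..n. broom_h t (n - r) k * broom_h t r 0) +
                       (\<Sum>j=1..k. real (k choose j) * broom_h t 0 (k - j) * broom_h t n j))"
  by pat_completeness auto
termination
  by (relation "Wellfounded.measure (\<lambda>(t, n, k). n + k)") auto

declare broom_h.simps(3) [simp del]

text \<open>Stack-sorting always puts the largest entry last, so prescribing it is no condition.\<close>
lemma broom_h_0_Suc: "broom_h t 0 (Suc k) = broom_h t (Suc 0) k"
  by (simp add: broom_h.simps(3))

definition egf :: "real \<Rightarrow> nat \<Rightarrow> real fps" where
  "egf t n = Abs_fps (\<lambda>k. broom_h t n k / fact k)"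

lemma egf_nth [simp]: "egf t n $ k = broom_h t n k / fact k"
  by (simp add: egf_def)

lemma binomial_convolution:
  fixes f g :: "real fps"
  assumes "\<And>j. f $ j = a j / fact j" "\<And>j. g $ j = b j / fact j"
  shows "(f * g) $ k = (\<Sum>j=0..k. real (k choose j) * a (k - j) * b j) / fact k"
proof -
  have "(f * g) $ k = (\<Sum>j=0..k. g $ j * f $ (k - j))"
    by (subst mult.commute) (simp add: fps_mult_nth)
  also have "\<dots> = (\<Sum>j=0..k. real (k choose j) * a (k - j) * b j / fact k)"
    by (intro sum.cong) (auto simp: assms binomial_fact field_simps)
  finally show ?thesis by (simp add: sum_divide_distrib)
qed

text \<open>The equation \<open>f' = gf\<close> determines every coefficient of \<open>f\<close> from the preceding ones.\<close>
lemma fps_linear_ode_zero: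
  fixes f g :: "real fps"
  assumes "fps_deriv f = g * f" "f $ 0 = 0"
  shows "f = 0"
proof (rule fps_ext)
  fix n
  show "f $ n = 0 $ n"
  proof (induction n rule: less_induct)
    case (less n)
    show ?case
    proof (cases n)
      case 0
      then show ?thesis using assms by simp
    next
      case (Suc m)
      have "real (Suc m) * f $ Suc m = (g * f) $ m"
        using arg_cong [OF assms(1), of "\<lambda>h. h $ m"] by (simp only: fps_deriv_nth) simp
      also have "\<dots> = 0"
        using less Suc by (simp add: fps_mult_nth)
      finally show ?thesis using Suc by simp
    qed
  qed
qed

text \<open>
  Euler's generating function \<open>E = (t - 1) / (t - e)\<close>. The recursion is the Riccati equation
  \<open>E' = tE\<^sup>2 - (t - 1)E\<close>. It makes \<open>M = E(t - e) - (t - 1)\<close> a solution of the linear equation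
  \<open>M' = tEM\<close> with \<open>M(0) = 0\<close>, hence \<open>M = 0\<close>.
\<close>
lemma egf_0_closed_form:
  "egf t 0 * (fps_const t - fps_exp (t - 1)) = fps_const (t - 1)"
proof -
  let ?E = "egf t 0" and ?x = "t - 1"
  let ?M = "?E * (fps_const t - fps_exp ?x)"
  have ode: "fps_deriv ?E = fps_const t * ?E * ?E - fps_const ?x * ?E"
  proof (rule fps_ext)
    fix k
    have "(?E * ?E) $ k = (\<Sum>j=0..k. real (k choose j) * broom_h t 0 (k - j) * broom_h t 0 j) / fact k"
      by (rule binomial_convolution) simp_all
    also have "\<dots> = (broom_h t 0 k + (\<Sum>j=1..k. real (k choose j) * broom_h t 0 (k - j) * broom_h t 0 j)) / fact k"
      by (subst sum.atLeast_Suc_atMost) simp_all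
    finally have "t * (?E * ?E) $ k = (broom_h t 0 (Suc k) + ?x * broom_h t 0 k) / fact k"
      by (simp add: field_simps)
    moreover have "fps_deriv ?E $ k = broom_h t 0 (Suc k) / fact k"
      by (simp del: of_nat_Suc broom_h.simps)
    ultimately show "fps_deriv ?E $ k = (fps_const t * ?E * ?E - fps_const ?x * ?E) $ k"
      by (simp add: mult.assoc add_divide_distrib del: broom_h.simps)
  qed
  have "?M - fps_const ?x = 0"
  proof (rule fps_linear_ode_zero)
    have "fps_deriv (?M - fps_const ?x) =
        fps_deriv ?E * (fps_const t - fps_exp ?x) - ?E * (fps_const ?x * fps_exp ?x)"
      by (simp add: algebra_simps)
    also have "\<dots> = (fps_const t * ?E) * (?M - fps_const ?x)"
      unfolding ode by (simp add: algebra_simps fps_const_mult[symmetric] fps_const_sub[symmetric] del: fps_const_mult fps_const_sub)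
    finally show "fps_deriv (?M - fps_const ?x) = (fps_const t * ?E) * (?M - fps_const ?x)" .
    show "(?M - fps_const ?x) $ 0 = 0" by (simp)
  qed
  then show ?thesis by simp
qed

text \<open>
  Ordinary in the outer variable, which marks the prescribed entries, and exponential in the inner
  one. Series in the inner variable alone, and numbers, enter as \<^const>\<open>fps_const\<close>.
\<close>
definition bgf :: "real \<Rightarrow> real fps fps" where
  "bgf t = Abs_fps (egf t)"

definition chain_gf :: "real \<Rightarrow> real fps fps" where
  "chain_gf t = Abs_fps (\<lambda>n. fps_const (broom_h t n 0))"

lemma bgf_nth [simp]: "bgf t $ n = egf t n"
  by (simp add: bgf_def)

lemma chain_gf_nth [simp]: "chain_gf t $ n = fps_const (broom_h t n 0)"
  by (simp add: chain_gf_def)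

lemma fps_shift_eq:
  fixes f g :: "'a::comm_ring_1 fps"
  assumes "\<And>n. f $ Suc n = g $ n"
  shows "f = fps_const (f $ 0) + fps_X * g"
proof (rule fps_ext)
  fix n show "f $ n = (fps_const (f $ 0) + fps_X * g) $ n"
    using assms by (cases n) simp_all
qed

text \<open>The quadratic equation of the Narayana generating function.\<close>
lemma chain_gf_equation:
  fixes t defines "T \<equiv> fps_const (fps_const t)"
  shows "chain_gf t = 1 + fps_X * (chain_gf t + T * ((chain_gf t - 1) * chain_gf t))"
proof -
  let ?N = "chain_gf t"
  have "?N = fps_const (?N $ 0) + fps_X * (?N + T * ((?N - 1) * ?N))"
  proof (rule fps_shift_eq)
    fix n
    have "((?N - 1) * ?N) $ n = (\<Sum>r=0..n. (?N - 1) $ r * ?N $ (n - r))"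
      by (simp add: fps_mult_nth)
    also have "\<dots> = (\<Sum>r=1..n. fps_const (broom_h t (n - r) 0 * broom_h t r 0))"
      by (subst sum.atLeast_Suc_atMost) (auto simp: mult.commute intro!: sum.cong)
    also have "\<dots> = fps_const (\<Sum>r=1..n. broom_h t (n - r) 0 * broom_h t r 0)"
      by (rule fps_ext) (simp add: fps_sum_nth sum.neutral)
    finally show "?N $ Suc n = (?N + T * ((?N - 1) * ?N)) $ n"
      by (simp add: T_def broom_h.simps(3))
  qed
  then show ?thesis by simp
qed

lemma bgf_equation:
  fixes t defines "T \<equiv> fps_const (fps_const t)" and "E \<equiv> fps_const (egf t 0)"
  shows "bgf t = E + fps_X * (bgf t + T * ((chain_gf t - 1) * bgf t + E * (bgf t - chain_gf t)))"
proof -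
  let ?N = "chain_gf t" and ?W = "bgf t"
  have "?W = fps_const (?W $ 0) + fps_X * (?W + T * ((?N - 1) * ?W + E * (?W - ?N)))"
  proof (rule fps_shift_eq)
    fix n
    show "?W $ Suc n = (?W + T * ((?N - 1) * ?W + E * (?W - ?N))) $ n"
    proof (rule fps_ext)
      fix k
      have "((?N - 1) * ?W) $ n = (\<Sum>r=1..n. fps_const (broom_h t r 0) * egf t (n - r))"
        unfolding fps_mult_nth by (subst sum.atLeast_Suc_atMost) (auto intro!: sum.cong)
      then have 1: "((?N - 1) * ?W) $ n $ k = (\<Sum>r=1..n. broom_h t (n - r) k * broom_h t r 0) / fact k"
        by (simp add: fps_sum_nth sum_divide_distrib mult.commute)
      have 2: "(E * (?W - ?N)) $ n $ k = (egf t 0 * (egf t n - fps_const (broom_h t n 0))) $ k"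
        by (simp add: E_def)
      also have "\<dots> =
          (\<Sum>j=0..k. real (k choose j) * broom_h t 0 (k - j) * (if j = 0 then 0 else broom_h t n j)) / fact k"
        by (rule binomial_convolution) auto
      also have "\<dots> = (\<Sum>j=1..k. real (k choose j) * broom_h t 0 (k - j) * broom_h t n j) / fact k"
        by (subst sum.atLeast_Suc_atMost) auto
      finally have 2: "(E * (?W - ?N)) $ n $ k = \<dots>" .
      have "(?W + T * ((?N - 1) * ?W + E * (?W - ?N))) $ n $ k =
          egf t n $ k + t * (((?N - 1) * ?W) $ n $ k + (E * (?W - ?N)) $ n $ k)"
        by (simp only: T_def fps_add_nth fps_mult_left_const_nth bgf_nth)
      then show "?W $ Suc n $ k = (?W + T * ((?N - 1) * ?W + E * (?W - ?N))) $ n $ k"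
        unfolding 1 2 by (simp add: broom_h.simps(3) add_divide_distrib ring_distribs)
    qed
  qed
  then show ?thesis by (simp add: E_def)
qed

text \<open>
  Multiplying the linear equation for \<open>W\<close> by \<open>t - e\<close> eliminates \<open>E\<close> in favour of \<open>x\<close>. After a further
  multiplication by \<open>1 - xzN\<close>, the quadratic equation for \<open>N\<close> makes \<open>1 - tzN\<close> a common factor of
  both sides. Its constant coefficient is 1, so it can be cancelled.
\<close>
lemma bgf_closed_form:
  fixes t defines "T \<equiv> fps_const (fps_const t)" and "x \<equiv> fps_const (fps_const (t - 1))"
    and "e \<equiv> fps_const (fps_exp (t - 1))"
  shows "bgf t * (T - e - x * T * (fps_X * chain_gf t)) = x * (1 - x * (fps_X * chain_gf t))"
proof -
  define W N E and z :: "real fps fps" where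
    "W = bgf t" and "N = chain_gf t" and "E = fps_const (egf t 0)" and "z = fps_X"
  have x: "x = T - 1"
    by (simp add: x_def T_def fps_const_sub [symmetric] del: fps_const_sub)
  have N: "N = 1 + z * (N + T * ((N - 1) * N))"
    using chain_gf_equation [of t] by (simp add: N_def T_def z_def)
  have W: "W = E + z * (W + T * ((N - 1) * W + E * (W - N)))"
    using bgf_equation [of t] by (simp add: N_def W_def T_def z_def E_def)
  have E: "E * (T - e) = x"
    using arg_cong [OF egf_0_closed_form [of t], of fps_const]
    by (simp add: E_def T_def e_def x_def)
  have "(1 - T * (z * N)) * (W * (T - e - x * T * (z * N))) =
      (1 - T * (z * N)) * (x * (1 - x * (z * N)))"
    using N W E x by algebra
  moreover have "1 - T * (z * N) \<noteq> 0"
  proof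
    assume "1 - T * (z * N) = 0"
    then have "(1 - T * (z * N)) $ 0 = 0" by simp
    then show False by (simp add: z_def)
  qed
  ultimately show ?thesis
    unfolding W_def N_def z_def by simp
qed

text \<open>
  The coefficient of \<open>z\<^sup>n u\<^sup>k / k!\<close> in \<open>W(t - e - xtzN) = x(1 - xzN)\<close>. For \<open>k \<ge> 1\<close> the right-hand side
  contributes nothing; the summand \<open>b = k\<close> of \<open>eW\<close>, moved to the left, turns \<open>t\<close> into \<open>t - 1\<close>.
\<close>
lemma broom_h_recurrence:
  assumes "k \<ge> 1"
  shows "(t - 1) * broom_h t n k =
    (\<Sum>b<k. real (k choose b) * (t - 1) ^ (k - b) * broom_h t n b) +
    (t - 1) * t * (\<Sum>r<n. broom_h t r 0 * broom_h t (n - 1 - r) k)"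
proof -
  let ?x = "t - 1"
  let ?T = "fps_const (fps_const t)" and ?X = "fps_const (fps_const ?x)"
    and ?e = "fps_const (fps_exp ?x)"
  let ?S = "\<Sum>r<n. broom_h t r 0 * broom_h t (n - 1 - r) k"
  have "(fps_X * (chain_gf t * bgf t)) $ n $ k = ?S / fact k"
  proof (cases n)
    case (Suc m)
    have "(fps_X * (chain_gf t * bgf t)) $ n $ k = (chain_gf t * bgf t) $ m $ k"
      by (simp add: Suc)
    also have "\<dots> = (\<Sum>r=0..m. (fps_const (broom_h t r 0) * egf t (m - r)) $ k)"
      by (subst fps_mult_nth) (simp only: fps_sum_nth chain_gf_nth bgf_nth)
    finally show ?thesis
      by (simp add: Suc sum_divide_distrib atLeast0AtMost lessThan_Suc_atMost)
  qed simp
  moreover have "(fps_exp ?x * egf t n) $ k =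
      (\<Sum>b=0..k. real (k choose b) * ?x ^ (k - b) * broom_h t n b) / fact k"
    by (rule binomial_convolution) simp_all
  moreover have "{0..k} = insert k {..<k}" by auto
  moreover have "(fps_X * chain_gf t) $ n $ k = 0"
    using assms by (cases n) auto
  moreover have "t * bgf t $ n $ k - (fps_exp ?x * egf t n) $ k
      - ?x * (t * (fps_X * (chain_gf t * bgf t)) $ n $ k) =
      ?X $ n $ k - ?x * (?x * (fps_X * chain_gf t) $ n $ k)"
  proof -
    have "?T * bgf t - ?e * bgf t - ?X * (?T * (fps_X * (chain_gf t * bgf t))) =
        ?X - ?X * (?X * (fps_X * chain_gf t))"
      using bgf_closed_form [of t] by algebra
    then have "(?T * bgf t - ?e * bgf t - ?X * (?T * (fps_X * (chain_gf t * bgf t)))) $ n $ k =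
        (?X - ?X * (?X * (fps_X * chain_gf t))) $ n $ k"
      by (rule arg_cong)
    then show ?thesis
      by (simp only: fps_sub_nth fps_mult_left_const_nth bgf_nth)
  qed
  moreover have "?X $ n $ k = 0"
    using assms by (cases n) auto
  ultimately have "t * (broom_h t n k / fact k) -
      (broom_h t n k + (\<Sum>b<k. real (k choose b) * ?x ^ (k - b) * broom_h t n b)) / fact k -
      ?x * (t * (?S / fact k)) = 0"
    by (simp del: fps_nth_fps_const)
  then have "(t * broom_h t n k - (broom_h t n k + (\<Sum>b<k. real (k choose b) * ?x ^ (k - b) * broom_h t n b)) - ?x * (t * ?S)) / fact k = 0"
    by (simp add: diff_divide_distrib)
  then show ?thesis by (simp add: algebra_simps)
qed


section \<open>Descents of stack-sorting preimages\<close>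

text \<open>The entry \<open>m\<close> exceeds everything read before it, so its arrival empties the stack.\<close>
lemma stack_sort_run_below_max:
  assumes "\<forall>x\<in>set L \<union> set st. x < m"
  shows "stack_sort_run (L @ m # R) st = stack_sort_run L st @ stack_sort_run R [m]"
  using assms
proof (induction L st rule: stack_sort_run.induct)
  case (1 st)
  then show ?case by (induction st) auto
qed auto

text \<open>An entry at the bottom of the stack that exceeds all later ones is popped only at the end.\<close>
lemma stack_sort_run_max_at_bottom:
  assumes "\<forall>x\<in>set R \<union> set st. x < m"
  shows "stack_sort_run R (st @ [m]) = stack_sort_run R st @ [m]"
  using assms by (induction R st rule: stack_sort_run.induct) auto

lemma stack_sort_split_max:
  assumes "\<forall>x\<in>set L \<union> set R. x < m"
  shows "stack_sort (L @ m # R) = stack_sort L @ stack_sort R @ [m]"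
  using stack_sort_run_below_max [of L "[]" m R] stack_sort_run_max_at_bottom [of R "[]" m] assms
  by (simp add: stack_sort_def)

lemma mset_stack_sort [simp]: "mset (stack_sort w) = mset w"
proof -
  have "mset (stack_sort_run xs st) = mset xs + mset st" for xs st
    by (induction xs st rule: stack_sort_run.induct) auto
  then show ?thesis by (simp add: stack_sort_def)
qed

lemma set_stack_sort [simp]: "set (stack_sort w) = set w"
  by (metis mset_stack_sort set_mset_mset)

lemma length_stack_sort [simp]: "length (stack_sort w) = length w"
  by (metis mset_stack_sort size_mset)

lemma num_descents_Nil [simp]: "num_descents [] = 0"
  by (simp add: num_descents_def)

lemma num_descents_Cons:
  "num_descents (x # w) = (if w \<noteq> [] \<and> hd w < x then 1 else 0) + num_descents w"
proof -
  let ?D = "\<lambda>w. {i. Suc i < length w \<and> w ! i > w ! Suc i}"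
  have fin: "finite (?D v)" for v
    by (rule finite_subset [of _ "{..<length v}"]) auto
  have "?D (x # w) = (if w \<noteq> [] \<and> hd w < x then {0} else {}) \<union> Suc ` ?D w"
    (is "?l = ?r")
  proof (rule set_eqI)
    fix i show "i \<in> ?l \<longleftrightarrow> i \<in> ?r"
      by (cases i) (auto simp: hd_conv_nth)
  qed
  moreover have "card (Suc ` ?D w) = card (?D w)"
    by (rule card_image) simp
  ultimately show ?thesis
    unfolding num_descents_def using fin [of w]
    by (cases "w \<noteq> [] \<and> hd w < x") (simp_all add: card_insert_if image_iff)
qed

lemma num_descents_split_max:
  assumes "\<forall>x\<in>set L \<union> set R. x < m"
  shows "num_descents (L @ m # R) = num_descents L + num_descents R + (if R = [] then 0 else 1)"
  using assms
proof (induction L)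
  case Nil
  then show ?case by (auto simp: num_descents_Cons)
next
  case (Cons a L)
  then show ?case by (cases L) (auto simp: num_descents_Cons)
qed

lemma sum_permutations_split_at:
  assumes "finite X" "m \<in> X"
  shows "(\<Sum>w\<in>permutations_of_set X. g w) =
    (\<Sum>Y\<in>Pow (X - {m}). \<Sum>L\<in>permutations_of_set Y.
       \<Sum>R\<in>permutations_of_set (X - {m} - Y). g (L @ m # R))"
proof -
  let ?S = "SIGMA Y:Pow (X - {m}). permutations_of_set Y \<times> permutations_of_set (X - {m} - Y)"
  have fin: "finite Y" if "Y \<in> Pow (X - {m})" for Y
    using that assms(1) by (auto intro: finite_subset)
  have "bij_betw (\<lambda>(Y, L, R). L @ m # R) ?S (permutations_of_set X)"
  proof (rule bij_betwI')
    fix a b assume "a \<in> ?S" "b \<in> ?S"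
    moreover obtain Y L R Y' L' R' where ab: "a = (Y, L, R)" "b = (Y', L', R')"
      by (metis prod_cases3)
    ultimately have "m \<notin> set L \<union> set R" "Y = set L" "Y' = set L'"
      by (auto simp: permutations_of_set_def)
    then show "((case a of (Y, L, R) \<Rightarrow> L @ m # R) = (case b of (Y, L, R) \<Rightarrow> L @ m # R)) = (a = b)"
      by (auto simp: ab append_Cons_eq_iff)
  next
    fix a assume "a \<in> ?S"
    then show "(case a of (Y, L, R) \<Rightarrow> L @ m # R) \<in> permutations_of_set X"
      using assms by (auto simp: permutations_of_set_def)
  next
    fix w assume w: "w \<in> permutations_of_set X"
    with assms obtain L R where "w = L @ m # R"
      by (metis permutations_of_setD(1) split_list)
    with w have "(set L, L, R) \<in> ?S" "w = (case (set L, L, R) of (Y, L, R) \<Rightarrow> L @ m # R)"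
      by (auto simp: permutations_of_set_def)
    then show "\<exists>a\<in>?S. w = (case a of (Y, L, R) \<Rightarrow> L @ m # R)" by blast
  qed
  then have "(\<Sum>w\<in>permutations_of_set X. g w) = (\<Sum>a\<in>?S. g (case a of (Y, L, R) \<Rightarrow> L @ m # R))"
    by (rule sum.reindex_bij_betw [symmetric])
  also have "\<dots> = (\<Sum>Y\<in>Pow (X - {m}). \<Sum>(L, R)\<in>permutations_of_set Y \<times> permutations_of_set (X - {m} - Y). g (L @ m # R))"
    using assms by (subst sum.Sigma) (auto simp: fin intro!: sum.cong)
  finally show ?thesis
    by (simp add: sum.cartesian_product)
qed

text \<open>
  The prescribed end \<open>h\<close> of the sorted word is kept as a list and the entries as an arbitrary set,
  so that the recursion can be applied to \<open>L\<close> and \<open>R\<close> without standardizing them.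
\<close>
definition preimage_descents :: "real \<Rightarrow> nat set \<Rightarrow> nat list \<Rightarrow> real" where
  "preimage_descents t X h =
     (\<Sum>w\<in>permutations_of_set X. if suffix h (stack_sort w) then t ^ num_descents w else 0)"

text \<open>
  With \<open>Y\<close> the set of entries of \<open>L\<close>, the word \<open>s(L)s(R)\<close> ends with \<open>h\<close> in two ways. If \<open>Y\<close> avoids
  \<open>h\<close>, all of \<open>h\<close> must be the end of \<open>s(R)\<close>. Otherwise \<open>s(R)\<close> is a proper final segment of \<open>h\<close>, so
  the set \<open>Y\<close> is determined by the number \<open>i \<ge> 1\<close> of entries of \<open>h\<close> in \<open>L\<close>, and \<open>s(L)\<close> ends with the
  first \<open>i\<close> entries of \<open>h\<close>. The factor \<open>u\<close> accounts for the descent after \<open>m\<close>, which is there unless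
  \<open>R\<close> is empty.
\<close>
lemma preimage_descents_split_max:
  fixes t :: real
  assumes X: "finite X" "m \<notin> X" "\<forall>x\<in>X. x < m" and h: "distinct h" "set h \<subseteq> X"
  defines "u \<equiv> \<lambda>Z::nat set. if Z = {} then 1 else t"
  shows "preimage_descents t (insert m X) (h @ [m]) =
    (\<Sum>Y\<in>Pow (X - set h). u (X - Y) * preimage_descents t Y [] * preimage_descents t (X - Y) h) +
    (\<Sum>i=1..length h. u (set (drop i h)) * preimage_descents t (X - set (drop i h)) (take i h) *
       preimage_descents t (set (drop i h)) (drop i h))"
proof -
  \<comment> \<open>\<open>G Y\<close> is the contribution of the words whose entries before \<open>m\<close> form the set \<open>Y\<close>.\<close>
  define G where "G = (\<lambda>Y. u (X - Y) * (\<Sum>L\<in>permutations_of_set Y. \<Sum>R\<in>permutations_of_set (X - Y).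
    if suffix h (stack_sort L @ stack_sort R) then t ^ num_descents L * t ^ num_descents R else 0))"
  have finY: "finite Y" if "Y \<in> Pow X" for Y
    using that X(1) by (auto intro: finite_subset)
  have "preimage_descents t (insert m X) (h @ [m]) = (\<Sum>Y\<in>Pow X. G Y)"
    unfolding preimage_descents_def
  proof (subst sum_permutations_split_at [of _ m], goal_cases)
    case 3
    have [simp]: "insert m X - {m} = X" using X by auto
    show ?case
      unfolding G_def sum_distrib_left
    proof (simp, intro sum.cong refl)
      fix Y L R
      assume *: "Y \<in> Pow X" "L \<in> permutations_of_set Y" "R \<in> permutations_of_set (X - Y)"
      then have **: "\<forall>x\<in>set L \<union> set R. x < m" "set R = X - Y"
        using X(3) by (auto simp: permutations_of_set_def)
      have "R = [] \<longleftrightarrow> X - Y = {}" using **(2) by (metis set_empty)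
      then show "(if suffix (h @ [m]) (stack_sort (L @ m # R)) then t ^ num_descents (L @ m # R) else 0) =
          u (X - Y) * (if suffix h (stack_sort L @ stack_sort R) then t ^ num_descents L * t ^ num_descents R else 0)"
        unfolding stack_sort_split_max [OF **(1)] num_descents_split_max [OF **(1)]
        by (simp add: u_def power_add flip: append_assoc)
    qed
  qed (use X in auto)
  also have "\<dots> = (\<Sum>Y\<in>Pow (X - set h) \<union> (\<lambda>i. X - set (drop i h)) ` {1..length h}. G Y)"
  proof (rule sum.mono_neutral_right)
    show "\<forall>Y\<in>Pow X - (Pow (X - set h) \<union> (\<lambda>i. X - set (drop i h)) ` {1..length h}). G Y = 0"
    proof
      fix Y assume Y: "Y \<in> Pow X - (Pow (X - set h) \<union> (\<lambda>i. X - set (drop i h)) ` {1..length h})"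
      have "\<not> suffix h (stack_sort L @ stack_sort R)"
        if LR: "L \<in> permutations_of_set Y" "R \<in> permutations_of_set (X - Y)" for L R
      proof
        assume "suffix h (stack_sort L @ stack_sort R)"
        then consider "suffix h (stack_sort R)" | h1 where "h = h1 @ stack_sort R" "suffix h1 (stack_sort L)"
          by (auto simp: suffix_append)
        then show False
        proof cases
          case 1
          then have "set h \<subseteq> X - Y"
            using LR(2) by (metis permutations_of_setD(1) set_mono_suffix set_stack_sort)
          then show False using Y by blast
        next
          case 2
          have "X - Y = set (drop (length h1) h)"
            using LR(2) 2 by (simp add: permutations_of_set_def)
          then have "Y = X - set (drop (length h1) h)" using Y by auto
          moreover have "length h1 \<in> {1..length h}"
            using 2 \<open>Y = _\<close> Y by (cases "h1 = []") (auto simp: Suc_le_eq)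
          ultimately show False using Y by blast
        qed
      qed
      then show "G Y = 0" unfolding G_def by (simp add: sum.neutral)
    qed
  qed (use X h in auto)
  also have "\<dots> = (\<Sum>Y\<in>Pow (X - set h). G Y) + (\<Sum>i=1..length h. G (X - set (drop i h)))"
  proof (subst sum.union_disjoint)
    have "X - set (drop i h) \<notin> Pow (X - set h)" if "i \<in> {1..length h}" for i
    proof -
      obtain a g where "h = a # g" using \<open>i \<in> {1..length h}\<close> by (cases h) auto
      moreover obtain l where "i = Suc l" using \<open>i \<in> {1..length h}\<close> by (cases i) auto
      ultimately have "set (drop i h) \<subseteq> set g" "a \<in> set h" "a \<notin> set g"
        using h(1) by (simp_all add: set_drop_subset)
      then have "a \<in> set h" "a \<notin> set (drop i h)" by blast+
      then show ?thesis using h by auto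
    qed
    then show "Pow (X - set h) \<inter> (\<lambda>i. X - set (drop i h)) ` {1..length h} = {}" by blast
    have "inj_on (\<lambda>i. X - set (drop i h)) {1..length h}"
    proof (rule inj_onI)
      fix i j assume ij: "i \<in> {1..length h}" "j \<in> {1..length h}" and "X - set (drop i h) = X - set (drop j h)"
      moreover have "set (drop l h) \<subseteq> X" for l using h(2) set_drop_subset by fast
      ultimately have "set (drop i h) = set (drop j h)" by blast
      then have "length h - i = length h - j"
        using h(1) by (metis distinct_card distinct_drop length_drop)
      then show "i = j" using ij by auto
    qed
    then show "(\<Sum>Y\<in>Pow (X - set h). G Y) + sum G ((\<lambda>i. X - set (drop i h)) ` {1..length h}) =
        (\<Sum>Y\<in>Pow (X - set h). G Y) + (\<Sum>i=1..length h. G (X - set (drop i h)))"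
      by (subst sum.reindex) auto
  qed (use X in auto)
  also have "(\<Sum>Y\<in>Pow (X - set h). G Y) =
      (\<Sum>Y\<in>Pow (X - set h). u (X - Y) * preimage_descents t Y [] * preimage_descents t (X - Y) h)"
  proof (intro sum.cong refl)
    fix Y assume Y: "Y \<in> Pow (X - set h)"
    have "suffix h (stack_sort L @ stack_sort R) \<longleftrightarrow> suffix h (stack_sort R)"
      if LR: "L \<in> permutations_of_set Y" "R \<in> permutations_of_set (X - Y)" for L R
    proof
      assume "suffix h (stack_sort L @ stack_sort R)"
      then consider "suffix h (stack_sort R)" | h1 where "h = h1 @ stack_sort R" "suffix h1 (stack_sort L)"
        by (auto simp: suffix_append)
      then show "suffix h (stack_sort R)"
      proof cases
        case 2
        then have "set h1 \<subseteq> Y" "set h1 \<subseteq> set h"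
          using LR(1) set_mono_suffix [OF 2(2)] by (auto simp: permutations_of_set_def)
        with Y have "h1 = []" by (cases h1) auto
        with 2 show ?thesis by simp
      qed
    qed (simp add: suffix_append)
    then show "G Y = u (X - Y) * preimage_descents t Y [] * preimage_descents t (X - Y) h"
      unfolding G_def preimage_descents_def mult.assoc sum_product
      by (intro arg_cong2 [where f = "(*)"] sum.cong refl) auto
  qed
  also have "(\<Sum>i=1..length h. G (X - set (drop i h))) =
     (\<Sum>i=1..length h. u (set (drop i h)) * preimage_descents t (X - set (drop i h)) (take i h) *
       preimage_descents t (set (drop i h)) (drop i h))"
  proof (intro sum.cong refl)
    fix i assume i: "i \<in> {1..length h}"
    have D: "X - (X - set (drop i h)) = set (drop i h)"
      using h(2) set_drop_subset [of i h] by blast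
    have "suffix h (stack_sort L @ stack_sort R) \<longleftrightarrow> suffix (take i h) (stack_sort L) \<and> suffix (drop i h) (stack_sort R)"
      if LR: "R \<in> permutations_of_set (set (drop i h))" for L R
    proof -
      have len: "length (stack_sort R) = length h - i"
        using LR h(1) by (simp add: permutations_of_set_def) (metis distinct_card distinct_drop length_drop)
      show ?thesis
      proof
        assume "suffix h (stack_sort L @ stack_sort R)"
        moreover have "\<not> suffix h (stack_sort R)"
          using len i by (auto dest!: suffix_length_le)
        ultimately obtain h1 where h1: "h = h1 @ stack_sort R" "suffix h1 (stack_sort L)"
          by (auto simp: suffix_append)
        then have "length h1 + (length h - i) = length h" using len by (metis length_append)
        then have "length h1 = i" using i by auto
        with h1 show "suffix (take i h) (stack_sort L) \<and> suffix (drop i h) (stack_sort R)"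
          by (metis append_eq_conv_conj suffix_order.refl)
      next
        assume *: "suffix (take i h) (stack_sort L) \<and> suffix (drop i h) (stack_sort R)"
        then obtain ys where ys: "stack_sort R = ys @ drop i h" by (auto simp: suffix_def)
        then have "length ys = 0" using arg_cong [OF ys, of length] unfolding len by simp
        then have "drop i h = stack_sort R" using ys by simp
        then have "h = take i h @ stack_sort R" by (metis append_take_drop_id)
        then show "suffix h (stack_sort L @ stack_sort R)"
          using * by (metis same_suffix_suffix suffix_append)
      qed
    qed
    then show "G (X - set (drop i h)) = u (set (drop i h)) * preimage_descents t (X - set (drop i h)) (take i h) *
       preimage_descents t (set (drop i h)) (drop i h)"
      unfolding G_def preimage_descents_def mult.assoc sum_product D
      by (intro arg_cong2 [where f = "(*)"] sum.cong refl) auto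
  qed
  finally show ?thesis .
qed


lemma preimage_descents_Nil:
  assumes "finite X" "m \<notin> X" "\<forall>x\<in>X. x < m"
  shows "preimage_descents t (insert m X) [] = preimage_descents t (insert m X) [m]"
  unfolding preimage_descents_def
proof (intro sum.cong refl)
  fix w assume w: "w \<in> permutations_of_set (insert m X)"
  then obtain L R where LR: "w = L @ m # R"
    by (metis insertI1 permutations_of_setD(1) split_list)
  then have "\<forall>x\<in>set L \<union> set R. x < m"
    using w assms by (auto simp: permutations_of_set_def)
  then have "suffix [m] (stack_sort w)"
    by (simp add: LR stack_sort_split_max suffix_def)
  then show "(if suffix [] (stack_sort w) then t ^ num_descents w else 0) =
      (if suffix [m] (stack_sort w) then t ^ num_descents w else 0)"
    by simp
qed

text \<open>
  Induction on the number of entries. The order assumption on \<open>h\<close> passes to both parts of the split,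
  which is why only the sizes of the sets matter.
\<close>
lemma preimage_descents_eq_broom_h:
  assumes "finite X" "sorted_wrt (<) h" "set h \<subseteq> X" "\<forall>a\<in>X - set h. \<forall>b\<in>set h. a < b"
  shows "preimage_descents t X h = broom_h t (length h) (card X - length h)"
  using assms
proof (induction "card X" arbitrary: X h rule: less_induct)
  case less
  \<comment> \<open>A nonempty prescribed end consists of top entries, so its last entry \<open>m\<close> is the maximum of \<open>X\<close>.\<close>
  have *: "preimage_descents t X (h' @ [m]) = broom_h t (Suc (length h')) (card X - Suc (length h'))"
    if h: "sorted_wrt (<) (h' @ [m])" "set (h' @ [m]) \<subseteq> X"
      "\<forall>a\<in>X - set (h' @ [m]). \<forall>b\<in>set (h' @ [m]). a < b" for h' m
  proof -
    define X' K n k where "X' = X - {m}" and "K = X' - set h'" and "n = length h'" and "k = card K"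
    let ?u = "\<lambda>Z::nat set. if Z = {} then 1 else t"
    have X': "X = insert m X'" "finite X'" "m \<notin> X'" "\<forall>x\<in>X'. x < m"
      using h less.prems(1) by (auto simp: X'_def sorted_wrt_append)
    have h': "sorted_wrt (<) h'" "distinct h'" "set h' \<subseteq> X'" "\<forall>a\<in>X' - set h'. \<forall>b\<in>set h'. a < b"
      using h by (auto simp: X'_def sorted_wrt_append strict_sorted_iff)
    have card_h': "card (set h') = n"
      using h' by (simp add: n_def distinct_card)
    have card_X': "card X' = n + k" "card X = Suc (n + k)"
    proof -
      have "card K = card X' - card (set h')" "card (set h') \<le> card X'"
        using h' X' by (auto simp: K_def card_Diff_subset card_mono)
      then show "card X' = n + k" "card X = Suc (n + k)"
        using card_h' X' by (auto simp: k_def)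
    qed
    have IH: "preimage_descents t Y g = broom_h t (length g) (card Y - length g)"
      if "Y \<subseteq> X'" "sorted_wrt (<) g" "set g \<subseteq> Y" "\<forall>a\<in>Y - set g. \<forall>b\<in>set g. a < b" for Y g
      using that card_X' X' card_mono [OF X'(2) that(1)]
      by (intro less.hyps) (auto intro: finite_subset)
    have "(\<Sum>Y\<in>Pow (X' - set h'). ?u (X' - Y) * preimage_descents t Y [] * preimage_descents t (X' - Y) h') =
        (\<Sum>Y\<in>Pow K. (if n + (k - card Y) = 0 then 1 else t) * broom_h t 0 (card Y) * broom_h t n (k - card Y))"
      unfolding K_def [symmetric]
    proof (intro sum.cong refl)
      fix Y assume "Y \<in> Pow K"
      then have Y: "Y \<subseteq> X'" "Y \<subseteq> K" "Y \<inter> set h' = {}" "finite Y"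
        using X' by (auto simp: K_def intro: finite_subset)
      have c: "card (X' - Y) = n + (k - card Y)"
        using Y X' card_X' card_mono [OF _ Y(2)] by (subst card_Diff_subset) (auto simp: k_def K_def)
      then have e: "X' - Y = {} \<longleftrightarrow> n + (k - card Y) = 0"
        using X' by (metis card_0_eq finite_Diff)
      have "preimage_descents t Y [] = broom_h t 0 (card Y)"
        using Y by (subst IH) auto
      moreover have "preimage_descents t (X' - Y) h' = broom_h t n (k - card Y)"
        using Y h' by (subst IH) (auto simp: c n_def)
      ultimately show "?u (X' - Y) * preimage_descents t Y [] * preimage_descents t (X' - Y) h' =
          (if n + (k - card Y) = 0 then 1 else t) * broom_h t 0 (card Y) * broom_h t n (k - card Y)"
        by (simp only: e)
    qed
    also have "\<dots> = (\<Sum>b\<le>k. real (k choose b) * ((if n + (k - b) = 0 then 1 else t) * broom_h t 0 b * broom_h t n (k - b)))"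
      unfolding k_def using X' by (subst sum_Pow_by_card) (auto simp: K_def)
    also have "\<dots> = (\<Sum>j=0..k. real (k choose j) * ((if n + j = 0 then 1 else t) * broom_h t 0 (k - j) * broom_h t n j))"
      by (rule sum.reindex_bij_witness [of _ "\<lambda>j. k - j" "\<lambda>j. k - j"])
        (auto simp: binomial_symmetric [symmetric])
    also have "\<dots> = (if n = 0 then 1 else t) * broom_h t 0 k * broom_h t n 0 +
        t * (\<Sum>j=1..k. real (k choose j) * broom_h t 0 (k - j) * broom_h t n j)"
      by (subst sum.atLeast_Suc_atMost) (auto simp: sum_distrib_left intro!: sum.cong)
    finally have first: "(\<Sum>Y\<in>Pow (X' - set h'). ?u (X' - Y) * preimage_descents t Y [] * preimage_descents t (X' - Y) h') = \<dots>" .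
    have "(\<Sum>i=1..length h'. ?u (set (drop i h')) * preimage_descents t (X' - set (drop i h')) (take i h') *
        preimage_descents t (set (drop i h')) (drop i h')) =
        (\<Sum>i=1..n. (if n - i = 0 then 1 else t) * broom_h t i k * broom_h t (n - i) 0)"
      unfolding n_def [symmetric]
    proof (intro sum.cong refl)
      fix i assume i: "i \<in> {1..n}"
      have sub: "set (drop i h') \<subseteq> X'"
        using h'(3) set_drop_subset by fast
      have c: "card (set (drop i h')) = n - i"
        using h'(2) by (simp add: distinct_card n_def)
      have split: "sorted_wrt (<) (take i h' @ drop i h')" "set (take i h' @ drop i h') \<subseteq> X'"
        "\<forall>a\<in>X' - set (take i h' @ drop i h'). \<forall>b\<in>set (take i h' @ drop i h'). a < b"
        using h' by simp_all
      have "preimage_descents t (set (drop i h')) (drop i h') = broom_h t (n - i) 0"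
        using sub split by (subst IH) (auto simp: c sorted_wrt_append n_def)
      moreover have "card (X' - set (drop i h')) = i + k"
        using sub i card_X' by (subst card_Diff_subset) (auto simp: c)
      moreover have "preimage_descents t (X' - set (drop i h')) (take i h') =
          broom_h t (length (take i h')) (card (X' - set (drop i h')) - length (take i h'))"
        using split by (intro IH) (fastforce simp: sorted_wrt_append simp del: append_take_drop_id)+
      moreover have "length (take i h') = i" using i by (simp add: n_def)
      moreover have "set (drop i h') = {} \<longleftrightarrow> n - i = 0" by (simp add: n_def)
      ultimately show "?u (set (drop i h')) * preimage_descents t (X' - set (drop i h')) (take i h') *
          preimage_descents t (set (drop i h')) (drop i h') =
          (if n - i = 0 then 1 else t) * broom_h t i k * broom_h t (n - i) 0"
        by simp
    qed
    also have "\<dots> = (\<Sum>r\<in>{0..<n}. (if r = 0 then 1 else t) * broom_h t (n - r) k * broom_h t r 0)"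
      by (rule sum.reindex_bij_witness [of _ "\<lambda>r. n - r" "\<lambda>i. n - i"]) auto
    also have "(if n = 0 then 1 else t) * broom_h t 0 k * broom_h t n 0 + \<dots> =
        broom_h t n k + t * (\<Sum>r=1..n. broom_h t (n - r) k * broom_h t r 0)"
    proof (cases n)
      case (Suc p)
      have "(\<Sum>r\<in>{0..<n}. (if r = 0 then 1 else t) * broom_h t (n - r) k * broom_h t r 0) =
          broom_h t n k + (\<Sum>r=1..p. t * broom_h t (n - r) k * broom_h t r 0)"
        unfolding Suc atLeastLessThanSuc_atLeastAtMost
        by (subst sum.atLeast_Suc_atMost) (auto intro!: sum.cong)
      then show ?thesis by (simp add: Suc sum_distrib_left algebra_simps)
    qed simp
    finally have "preimage_descents t X (h' @ [m]) = broom_h t (Suc n) k"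
      unfolding X'(1) preimage_descents_split_max [OF X'(2-4) h'(2,3)] first
      by (simp add: broom_h.simps(3) algebra_simps)
    then show ?thesis using card_X' by (simp add: n_def)
  qed
  show ?case
  proof (cases h rule: rev_cases)
    case (snoc h' m)
    then show ?thesis using * [of h' m] less.prems by simp
  next
    case Nil
    show ?thesis
    proof (cases "X = {}")
      case True
      then show ?thesis by (simp add: Nil preimage_descents_def)
    next
      case False
      define m X' where "m = Max X" and "X' = X - {m}"
      have m: "m \<in> X" "\<forall>x\<in>X'. x < m"
        using False less.prems(1) by (auto simp: m_def X'_def less_le)
      then have X': "X = insert m X'" "m \<notin> X'" "finite X'"
        using less.prems(1) by (auto simp: X'_def)
      then have "card X = Suc (card X')" by simp
      moreover have "preimage_descents t X [] = preimage_descents t X ([] @ [m])"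
        using X' m preimage_descents_Nil by simp
      moreover have "\<dots> = broom_h t 1 (card X - 1)"
        using * [of "[]" m] X' m by auto
      ultimately show ?thesis
        by (simp add: Nil broom_h_0_Suc del: broom_h.simps)
    qed
  qed
qed

text \<open>A permutation fixes the positions above \<open>k\<close> iff its word ends with \<open>k + 1, \<dots>, n + k\<close>.\<close>
lemma stack_sort_preimage_eq:
  "stack_sort_preimage (n + k) (perms_fixing_above n k) =
    {w \<in> permutations_of_set {1..n + k}. suffix [Suc k..<Suc (n + k)] (stack_sort w)}"
proof -
  have "v \<in> perms_fixing_above n k \<longleftrightarrow> suffix [Suc k..<Suc (n + k)] v"
    if v: "v \<in> permutations_of_set {1..n + k}" for v
  proof -
    have len: "length v = n + k"
      using v by (metis card_atLeastAtMost diff_Suc_1 distinct_card permutations_of_setD)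
    have "suffix [Suc k..<Suc (n + k)] v \<longleftrightarrow> drop k v = [Suc k..<Suc (n + k)]"
    proof
      assume "suffix [Suc k..<Suc (n + k)] v"
      then obtain u where u: "v = u @ [Suc k..<Suc (n + k)]" by (auto simp: suffix_def)
      then have "length u = k" using len by (auto simp del: upt_Suc)
      then show "drop k v = [Suc k..<Suc (n + k)]" using u by simp
    qed (metis suffix_drop)
    also have "\<dots> \<longleftrightarrow> (\<forall>j<n. v ! (k + j) = Suc k + j)"
      using len by (simp add: list_eq_iff_nth_eq del: upt_Suc)
    also have "\<dots> \<longleftrightarrow> (\<forall>i. k < i \<and> i \<le> n + k \<longrightarrow> v ! (i - 1) = i)"
    proof (intro iffI allI impI)
      fix i assume *: "\<forall>j<n. v ! (k + j) = Suc k + j" and i: "k < i \<and> i \<le> n + k"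
      then show "v ! (i - 1) = i" using spec [OF *, of "i - 1 - k"] by auto
    next
      fix j assume *: "\<forall>i. k < i \<and> i \<le> n + k \<longrightarrow> v ! (i - 1) = i" and j: "j < n"
      then show "v ! (k + j) = Suc k + j" using spec [OF *, of "Suc k + j"] by auto
    qed
    finally show ?thesis using v by (auto simp: perms_fixing_above_def)
  qed
  moreover have "stack_sort w \<in> permutations_of_set {1..n + k}"
    if "w \<in> permutations_of_set {1..n + k}" for w
    using that by (metis mset_stack_sort permutations_of_setD permutations_of_setI set_stack_sort mset_eq_imp_distinct_iff)
  ultimately show ?thesis
    unfolding stack_sort_preimage_def by blast
qed

lemma descent_sum_eq_broom_h:
  "(\<Sum>w\<in>stack_sort_preimage (n + k) (perms_fixing_above n k). t ^ num_descents w) = broom_h t n k"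
proof -
  have "(\<Sum>w\<in>stack_sort_preimage (n + k) (perms_fixing_above n k). t ^ num_descents w) =
      preimage_descents t {1..n + k} [Suc k..<Suc (n + k)]"
    unfolding stack_sort_preimage_eq preimage_descents_def by (rule sum.inter_filter) simp
  also have "\<dots> = broom_h t n k"
    by (subst preimage_descents_eq_broom_h) (auto simp del: upt_Suc)
  finally show ?thesis .
qed


section \<open>Laminar families\<close>

definition laminar_families :: "'a set set \<Rightarrow> 'a set set set" where
  "laminar_families C = {T. T \<subseteq> C \<and> (\<forall>\<sigma>\<in>T. \<forall>\<tau>\<in>T. \<sigma> \<subseteq> \<tau> \<or> \<tau> \<subseteq> \<sigma> \<or> \<sigma> \<inter> \<tau> = {})}"

definition laminar_sum :: "real \<Rightarrow> 'a set set \<Rightarrow> real" where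
  "laminar_sum y C = (\<Sum>T\<in>laminar_families C. y ^ card T)"

lemma laminar_families_subset: "T \<in> laminar_families C \<Longrightarrow> T \<subseteq> C"
  by (simp add: laminar_families_def)

lemma finite_laminar_families: "finite C \<Longrightarrow> finite (laminar_families C)"
  by (rule finite_subset [of _ "Pow C"]) (auto simp: laminar_families_def)

lemma laminar_sum_empty [simp]: "laminar_sum y {} = 1"
proof -
  have "laminar_families ({} :: 'a set set) = {{}}" by (auto simp: laminar_families_def)
  then show ?thesis by (simp add: laminar_sum_def)
qed

text \<open>The largest set can be added to, or removed from, every laminar family.\<close>
lemma laminar_sum_top:
  assumes "finite C" "G \<in> C" "\<forall>\<tau>\<in>C. \<tau> \<subseteq> G"
  shows "laminar_sum y C = (1 + y) * laminar_sum y (C - {G})"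
proof -
  let ?L = "laminar_families (C - {G})"
  have fin: "finite ?L" "\<And>T. T \<in> ?L \<Longrightarrow> finite T"
    using assms(1) by (auto simp: finite_laminar_families laminar_families_def intro: finite_subset)
  have "laminar_families C = ?L \<union> insert G ` ?L"
  proof
    show "laminar_families C \<subseteq> ?L \<union> insert G ` ?L"
    proof
      fix T assume T: "T \<in> laminar_families C"
      then have "T - {G} \<in> ?L" by (auto simp: laminar_families_def)
      moreover have "T = T - {G} \<or> T = insert G (T - {G})" by auto
      ultimately show "T \<in> ?L \<union> insert G ` ?L" by (metis UnCI image_eqI)
    qed
    have "insert G T \<in> laminar_families C" if "T \<in> ?L" for T
    proof -
      have T: "T \<subseteq> C" "\<And>\<sigma> \<tau>. \<sigma> \<in> T \<Longrightarrow> \<tau> \<in> T \<Longrightarrow> \<sigma> \<subseteq> \<tau> \<or> \<tau> \<subseteq> \<sigma> \<or> \<sigma> \<inter> \<tau> = {}"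
        using that by (auto simp: laminar_families_def)
      then have "\<sigma> \<subseteq> \<tau> \<or> \<tau> \<subseteq> \<sigma> \<or> \<sigma> \<inter> \<tau> = {}" if "\<sigma> \<in> insert G T" "\<tau> \<in> insert G T" for \<sigma> \<tau>
        using that assms(3) by (metis insertE order_refl subsetD)
      then show ?thesis using T(1) assms(2) by (simp add: laminar_families_def)
    qed
    moreover have "?L \<subseteq> laminar_families C"
      by (auto simp: laminar_families_def)
    ultimately show "?L \<union> insert G ` ?L \<subseteq> laminar_families C"
      by blast
  qed
  moreover have "inj_on (insert G) ?L"
  proof (rule inj_onI)
    fix T T' assume "T \<in> ?L" "T' \<in> ?L" and eq: "insert G T = insert G T'"
    then have "G \<notin> T" "G \<notin> T'" by (auto simp: laminar_families_def)
    then show "T = T'" using eq by (simp add: insert_ident)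
  qed
  moreover have "?L \<inter> insert G ` ?L = {}" by (auto simp: laminar_families_def)
  moreover have "(\<Sum>T\<in>?L. y ^ card (insert G T)) = (\<Sum>T\<in>?L. y * y ^ card T)"
  proof (intro sum.cong refl)
    fix T assume "T \<in> ?L"
    then have "G \<notin> T" "finite T" using fin by (auto simp: laminar_families_def)
    then show "y ^ card (insert G T) = y * y ^ card T" by simp
  qed
  ultimately show ?thesis
    unfolding laminar_sum_def using fin
    by (simp add: sum.union_disjoint sum.reindex sum_distrib_left ring_distribs sum.distrib)
qed

text \<open>
  In a laminar family the sets containing \<open>p\<close> form a chain. If there are any, let \<open>M\<close> be the largest;
  every other member lies strictly inside \<open>M\<close> or is disjoint from it, and these two parts are
  independent laminar families. The empty set is excluded because it would qualify for both parts.
\<close>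
lemma laminar_sum_split_point:
  assumes "finite C" "{} \<notin> C"
  shows "laminar_sum y C = laminar_sum y {\<tau>\<in>C. p \<notin> \<tau>} +
    (\<Sum>M\<in>{M\<in>C. p \<in> M}. y * laminar_sum y {\<tau>\<in>C. \<tau> \<subset> M} * laminar_sum y {\<tau>\<in>C. \<tau> \<inter> M = {}})"
proof -
  define L where "L = (\<lambda>M. {T \<in> laminar_families C. M \<in> T \<and> (\<forall>\<tau>\<in>T. p \<in> \<tau> \<longrightarrow> \<tau> \<subseteq> M)})"
  let ?C0 = "{\<tau>\<in>C. p \<notin> \<tau>}" and ?C1 = "{M\<in>C. p \<in> M}"
  have cover: "laminar_families C = laminar_families ?C0 \<union> (\<Union>M\<in>?C1. L M)"
  proof
    show "laminar_families C \<subseteq> laminar_families ?C0 \<union> (\<Union>M\<in>?C1. L M)"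
    proof
      fix T assume T: "T \<in> laminar_families C"
      show "T \<in> laminar_families ?C0 \<union> (\<Union>M\<in>?C1. L M)"
      proof (cases "{\<tau>\<in>T. p \<in> \<tau>} = {}")
        case True
        then show ?thesis using T by (auto simp: laminar_families_def)
      next
        case False
        have "finite {\<tau>\<in>T. p \<in> \<tau>}"
          using T assms(1) by (auto simp: laminar_families_def intro: finite_subset)
        from finite_has_maximal [OF this False]
        obtain M where M: "M \<in> T" "p \<in> M" "\<forall>\<tau>\<in>T. p \<in> \<tau> \<longrightarrow> M \<subseteq> \<tau> \<longrightarrow> M = \<tau>"
          by auto
        \<comment> \<open>Sets containing \<open>p\<close> are not disjoint, so a maximal one is the largest one.\<close>
        have "\<forall>\<tau>\<in>T. p \<in> \<tau> \<longrightarrow> \<tau> \<subseteq> M"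
        proof (intro ballI impI)
          fix \<tau> assume "\<tau> \<in> T" "p \<in> \<tau>"
          then have "\<tau> \<subseteq> M \<or> M \<subseteq> \<tau> \<or> \<tau> \<inter> M = {}" using T M(1) unfolding laminar_families_def by blast
          then show "\<tau> \<subseteq> M" using M \<open>\<tau> \<in> T\<close> \<open>p \<in> \<tau>\<close> by blast
        qed
        then have "T \<in> L M" "M \<in> ?C1" using T M by (auto simp: L_def laminar_families_def)
        then show ?thesis by blast
      qed
    qed
    show "laminar_families ?C0 \<union> (\<Union>M\<in>?C1. L M) \<subseteq> laminar_families C"
      by (auto simp: L_def laminar_families_def)
  qed
  have fin: "finite (laminar_families D)" "\<And>T. T \<in> laminar_families D \<Longrightarrow> finite T"
    if "D \<subseteq> C" for D
    using that assms(1) finite_subset [OF that assms(1)]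
    by (auto simp: finite_laminar_families laminar_families_def intro: finite_subset)
  have finL: "finite (L M)" for M
    using fin(1) [of C] by (auto simp: L_def)
  have "laminar_sum y C = laminar_sum y ?C0 + (\<Sum>T\<in>(\<Union>M\<in>?C1. L M). y ^ card T)"
    unfolding laminar_sum_def cover
    using assms(1) finL fin(1) [of ?C0]
    by (intro sum.union_disjoint) (auto simp: L_def laminar_families_def)
  also have "(\<Sum>T\<in>(\<Union>M\<in>?C1. L M). y ^ card T) = (\<Sum>M\<in>?C1. \<Sum>T\<in>L M. y ^ card T)"
  proof (rule sum.UNION_disjoint)
    show "\<forall>i\<in>?C1. \<forall>j\<in>?C1. i \<noteq> j \<longrightarrow> L i \<inter> L j = {}"
      unfolding L_def by blast
  qed (use assms(1) finL in auto)
  also have "\<dots> = (\<Sum>M\<in>?C1. y * laminar_sum y {\<tau>\<in>C. \<tau> \<subset> M} * laminar_sum y {\<tau>\<in>C. \<tau> \<inter> M = {}})"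
  proof (intro sum.cong refl)
    fix M assume M: "M \<in> ?C1"
    let ?A = "{\<tau>\<in>C. \<tau> \<subset> M}" and ?B = "{\<tau>\<in>C. \<tau> \<inter> M = {}}"
    let ?LA = "laminar_families ?A" and ?LB = "laminar_families ?B"
    let ?g = "\<lambda>(T1, T2). insert M (T1 \<union> T2)"
    have "\<tau> = {}" if "\<tau> \<in> ?A \<inter> ?B" for \<tau> using that by blast
    then have "?A \<inter> ?B = {}" using assms(2) by blast
    then have AB: "M \<notin> ?A" "M \<notin> ?B" "?A \<inter> ?B = {}"
      using M by auto
    have *: "insert M (T1 \<union> T2) \<inter> A = T1 \<and> insert M (T1 \<union> T2) \<inter> B = T2"
      if "M \<notin> A" "M \<notin> B" "A \<inter> B = {}" "T1 \<subseteq> A" "T2 \<subseteq> B" for T1 T2 A B :: "'a set set"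
      using that by blast
    have **: "T1 \<inter> T2 = {} \<and> M \<notin> T1 \<union> T2"
      if "M \<notin> A" "M \<notin> B" "A \<inter> B = {}" "T1 \<subseteq> A" "T2 \<subseteq> B" for T1 T2 A B :: "'a set set"
      using that by blast
    have "bij_betw ?g (?LA \<times> ?LB) (L M)"
    proof (rule bij_betw_byWitness [where f' = "\<lambda>T. (T \<inter> ?A, T \<inter> ?B)"])
      show "\<forall>a\<in>?LA \<times> ?LB. (?g a \<inter> ?A, ?g a \<inter> ?B) = a"
      proof (clarify, intro conjI)
        fix T1 T2 assume "T1 \<in> ?LA" "T2 \<in> ?LB"
        then have "T1 \<subseteq> ?A" "T2 \<subseteq> ?B" by (simp_all add: laminar_families_def)
        then show "insert M (T1 \<union> T2) \<inter> ?A = T1" "insert M (T1 \<union> T2) \<inter> ?B = T2"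
          using * [OF AB] by simp_all
      qed
      show "\<forall>T\<in>L M. ?g (T \<inter> ?A, T \<inter> ?B) = T"
      proof
        fix T assume T: "T \<in> L M"
        have "\<tau> \<in> ?A \<or> \<tau> \<in> ?B" if "\<tau> \<in> T" "\<tau> \<noteq> M" for \<tau>
        proof -
          have "\<tau> \<in> C" "M \<in> T" and top: "p \<in> \<tau> \<Longrightarrow> \<tau> \<subseteq> M"
            using T that(1) by (auto simp: L_def laminar_families_def)
          have "\<tau> \<subseteq> M \<or> M \<subseteq> \<tau> \<or> \<tau> \<inter> M = {}"
            using T that(1) \<open>M \<in> T\<close> by (simp add: L_def laminar_families_def)
          then consider "\<tau> \<subseteq> M" | "M \<subseteq> \<tau>" | "\<tau> \<inter> M = {}" by blast
          then show ?thesis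
          proof cases
            case 2
            then have "\<tau> \<subseteq> M" using M top by blast
            then show ?thesis using 2 that(2) by simp
          qed (use \<open>\<tau> \<in> C\<close> that(2) in auto)
        qed
        then show "?g (T \<inter> ?A, T \<inter> ?B) = T"
          using T by (auto simp: L_def)
      qed
      show "?g ` (?LA \<times> ?LB) \<subseteq> L M"
      proof (clarify)
        fix T1 T2 assume "T1 \<in> ?LA" "T2 \<in> ?LB"
        then have 1: "T1 \<subseteq> ?A" "T2 \<subseteq> ?B"
          "\<And>\<sigma> \<tau>. \<sigma> \<in> T1 \<Longrightarrow> \<tau> \<in> T1 \<Longrightarrow> \<sigma> \<subseteq> \<tau> \<or> \<tau> \<subseteq> \<sigma> \<or> \<sigma> \<inter> \<tau> = {}"
          "\<And>\<sigma> \<tau>. \<sigma> \<in> T2 \<Longrightarrow> \<tau> \<in> T2 \<Longrightarrow> \<sigma> \<subseteq> \<tau> \<or> \<tau> \<subseteq> \<sigma> \<or> \<sigma> \<inter> \<tau> = {}"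
          by (simp_all add: laminar_families_def)
        have 2: "\<sigma> \<inter> \<tau> = {}" if "\<sigma> \<in> T1" "\<tau> \<in> T2" for \<sigma> \<tau>
          using that 1(1,2) by blast
        have 3: "\<tau> \<subseteq> M" if "\<tau> \<in> T1" for \<tau> using that 1(1) by blast
        have 4: "\<tau> \<inter> M = {}" if "\<tau> \<in> T2" for \<tau> using that 1(2) by blast
        have "\<sigma> \<subseteq> \<tau> \<or> \<tau> \<subseteq> \<sigma> \<or> \<sigma> \<inter> \<tau> = {}" 
          if "\<sigma> \<in> insert M (T1 \<union> T2)" "\<tau> \<in> insert M (T1 \<union> T2)" for \<sigma> \<tau>
          using that 1(3,4) 2 3 4 by (metis Int_commute UnE insertE order_refl)
        then have "\<forall>\<sigma>\<in>insert M (T1 \<union> T2). \<forall>\<tau>\<in>insert M (T1 \<union> T2). \<sigma> \<subseteq> \<tau> \<or> \<tau> \<subseteq> \<sigma> \<or> \<sigma> \<inter> \<tau> = {}"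
          by (intro ballI)
        moreover have "insert M (T1 \<union> T2) \<subseteq> C" using 1(1,2) M by blast
        moreover have "\<forall>\<tau>\<in>insert M (T1 \<union> T2). p \<in> \<tau> \<longrightarrow> \<tau> \<subseteq> M"
          using 3 4 M by blast
        ultimately show "insert M (T1 \<union> T2) \<in> L M"
          unfolding L_def laminar_families_def mem_Collect_eq by (intro conjI insertI1) assumption+
      qed
      show "(\<lambda>T. (T \<inter> ?A, T \<inter> ?B)) ` L M \<subseteq> ?LA \<times> ?LB"
        by (auto simp: L_def laminar_families_def)
    qed
    then have "(\<Sum>T\<in>L M. y ^ card T) = (\<Sum>a\<in>?LA \<times> ?LB. y ^ card (?g a))"
      by (rule sum.reindex_bij_betw [symmetric])
    also have "\<dots> = (\<Sum>(T1, T2)\<in>?LA \<times> ?LB. y * (y ^ card T1 * y ^ card T2))"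
    proof (rule sum.cong [OF refl])
      fix a assume a: "a \<in> ?LA \<times> ?LB"
      define T1 T2 where "T1 = fst a" and "T2 = snd a"
      have T: "T1 \<in> ?LA" "T2 \<in> ?LB" using a by (auto simp: T1_def T2_def)
      have "finite T1" by (rule fin(2) [OF _ T(1)]) simp
      moreover have "finite T2" by (rule fin(2) [OF _ T(2)]) simp
      moreover have "T1 \<inter> T2 = {}" "M \<notin> T1 \<union> T2"
        using ** [OF AB laminar_families_subset [OF T(1)] laminar_families_subset [OF T(2)]] by simp_all
      ultimately have "y ^ card (insert M (T1 \<union> T2)) = y * (y ^ card T1 * y ^ card T2)"
        by (simp add: card_Un_disjoint power_add)
      then show "y ^ card (?g a) = (case a of (T1, T2) \<Rightarrow> y * (y ^ card T1 * y ^ card T2))"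
        by (simp only: case_prod_unfold T1_def T2_def)
    qed
    also have "\<dots> = y * (\<Sum>(T1, T2)\<in>?LA \<times> ?LB. y ^ card T1 * y ^ card T2)"
      by (simp only: sum_distrib_left case_prod_unfold)
    also have "\<dots> = y * laminar_sum y ?A * laminar_sum y ?B"
      by (simp only: laminar_sum_def sum_product sum.cartesian_product mult.assoc)
    finally show "(\<Sum>T\<in>L M. y ^ card T) = y * laminar_sum y ?A * laminar_sum y ?B" .
  qed
  finally show ?thesis .
qed


section \<open>Laminar families of subtubes of a broom\<close>

text \<open>
  The set of the chain elements \<open>i, \<dots>, j\<close> together with the leaves in \<open>S\<close>. For \<open>i \<le> j\<close> it is
  connected in the broom only if \<open>S\<close> is empty or \<open>j\<close> is the top of the chain.
\<close>
definition subbroom :: "nat \<Rightarrow> nat \<Rightarrow> nat set \<Rightarrow> (nat + nat) set" where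
  "subbroom i j S = Inl ` {i..j} \<union> Inr ` S"

lemma Inl_in_subbroom [simp]: "Inl a \<in> subbroom i j S \<longleftrightarrow> i \<le> a \<and> a \<le> j"
  and Inr_in_subbroom [simp]: "Inr b \<in> subbroom i j S \<longleftrightarrow> b \<in> S"
  by (auto simp: subbroom_def)

lemma subbroom_subset_iff:
  assumes "i \<le> j"
  shows "subbroom i j S \<subseteq> subbroom i' j' S' \<longleftrightarrow> i' \<le> i \<and> j \<le> j' \<and> S \<subseteq> S'"
proof
  assume sub: "subbroom i j S \<subseteq> subbroom i' j' S'"
  have "Inl i \<in> subbroom i' j' S'" "Inl j \<in> subbroom i' j' S'"
    using subsetD [OF sub, of "Inl i"] subsetD [OF sub, of "Inl j"] assms by simp_all
  moreover have "S \<subseteq> S'"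
  proof
    fix b assume "b \<in> S"
    then show "b \<in> S'" using subsetD [OF sub, of "Inr b"] by simp
  qed
  ultimately show "i' \<le> i \<and> j \<le> j' \<and> S \<subseteq> S'" by simp
qed (auto simp: subbroom_def)

lemma subbroom_eq_iff:
  assumes "i \<le> j"
  shows "subbroom i j S = subbroom i' j' S' \<longleftrightarrow> i = i' \<and> j = j' \<and> S = S'"
proof
  assume *: "subbroom i j S = subbroom i' j' S'"
  then have 1: "i' \<le> i" "j \<le> j'" "S \<subseteq> S'"
    using subbroom_subset_iff [OF assms] by blast+
  then have "i' \<le> j'" using assms by simp
  then have "i \<le> i'" "j' \<le> j" "S' \<subseteq> S"
    using * subbroom_subset_iff by blast+
  with 1 show "i = i' \<and> j = j' \<and> S = S'" by auto
qed simp

lemma subbroom_disjoint_iff: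
  assumes "i \<le> j" "i' \<le> j'"
  shows "subbroom i j S \<inter> subbroom i' j' S' = {} \<longleftrightarrow> (j < i' \<or> j' < i) \<and> S \<inter> S' = {}"
proof
  assume *: "subbroom i j S \<inter> subbroom i' j' S' = {}"
  have "Inl (max i i') \<notin> subbroom i j S \<inter> subbroom i' j' S'" using * by blast
  moreover have "Inr b \<notin> subbroom i j S \<inter> subbroom i' j' S'" for b using * by blast
  ultimately show "(j < i' \<or> j' < i) \<and> S \<inter> S' = {}" using assms by auto
qed (auto simp: subbroom_def)

text \<open>
  The tubes with at least two elements of the broom with chain \<open>l, \<dots>, h\<close> and leaf set \<open>S\<close>. The pieces
  cut out of a broom by a tube are again of this form, with other \<open>l\<close>, \<open>h\<close> and \<open>S\<close>.
\<close>
definition subtubes :: "nat \<Rightarrow> nat \<Rightarrow> nat set \<Rightarrow> (nat + nat) set set" where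
  "subtubes l h S = {subbroom i j S' | i j S'. l \<le> i \<and> i \<le> j \<and> j \<le> h \<and> S' \<subseteq> S \<and>
     (j < h \<longrightarrow> S' = {}) \<and> (i < j \<or> S' \<noteq> {})}"

definition proper_subtubes :: "nat \<Rightarrow> nat \<Rightarrow> nat set \<Rightarrow> (nat + nat) set set" where
  "proper_subtubes l h S = subtubes l h S - {subbroom l h S}"

lemma finite_subtubes: "finite S \<Longrightarrow> finite (subtubes l h S)"
  by (rule finite_subset [of _ "(\<lambda>(i, j, S'). subbroom i j S') ` ({..h} \<times> {..h} \<times> Pow S)"])
    (force simp: subtubes_def)+

lemma subtubes_trivial: "subtubes h h {} = {}"
  by (auto simp: subtubes_def)

lemma subbroom_in_subtubes_iff:
  assumes "i \<le> j"
  shows "subbroom i j S' \<in> subtubes l h S \<longleftrightarrow>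
    l \<le> i \<and> j \<le> h \<and> S' \<subseteq> S \<and> (j < h \<longrightarrow> S' = {}) \<and> (i < j \<or> S' \<noteq> {})"
  unfolding subtubes_def mem_Collect_eq using assms by (metis subbroom_eq_iff)

lemma subbroom_in_proper_subtubes_iff:
  assumes "i \<le> j"
  shows "subbroom i j S' \<in> proper_subtubes l h S \<longleftrightarrow>
    l \<le> i \<and> j \<le> h \<and> S' \<subseteq> S \<and> (j < h \<longrightarrow> S' = {}) \<and> (i < j \<or> S' \<noteq> {}) \<and>
    \<not> (i = l \<and> j = h \<and> S' = S)"
  using assms by (auto simp: proper_subtubes_def subbroom_in_subtubes_iff subbroom_eq_iff)

lemma eq_if_same_subbrooms:
  assumes "\<And>\<tau>. \<tau> \<in> A \<Longrightarrow> \<exists>i j S. i \<le> j \<and> \<tau> = subbroom i j S"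
    and "\<And>\<tau>. \<tau> \<in> B \<Longrightarrow> \<exists>i j S. i \<le> j \<and> \<tau> = subbroom i j S"
    and "\<And>i j S. i \<le> j \<Longrightarrow> subbroom i j S \<in> A \<longleftrightarrow> subbroom i j S \<in> B"
  shows "A = B"
  using assms by blast

lemma subtubes_are_subbrooms:
  "\<tau> \<in> subtubes l h S \<Longrightarrow> \<exists>i j S'. i \<le> j \<and> \<tau> = subbroom i j S'"
  by (auto simp: subtubes_def)

lemma proper_subtubes_are_subbrooms:
  "\<tau> \<in> proper_subtubes l h S \<Longrightarrow> \<exists>i j S'. i \<le> j \<and> \<tau> = subbroom i j S'"
  by (auto simp: proper_subtubes_def dest: subtubes_are_subbrooms)

lemma proper_subtubes_avoiding_bottom:
  "{\<tau>\<in>proper_subtubes l h S. Inl l \<notin> \<tau>} = (if l < h then subtubes (Suc l) h S else {})"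
proof (rule eq_if_same_subbrooms)
  show "subbroom i j T \<in> {\<tau>\<in>proper_subtubes l h S. Inl l \<notin> \<tau>} \<longleftrightarrow>
      subbroom i j T \<in> (if l < h then subtubes (Suc l) h S else {})" if "i \<le> j" for i j T
    using that by (auto simp: subbroom_in_proper_subtubes_iff subbroom_in_subtubes_iff)
qed (blast intro: proper_subtubes_are_subbrooms, metis emptyE subtubes_are_subbrooms)

lemma proper_subtubes_containing_bottom:
  assumes "l \<le> h"
  shows "{\<tau>\<in>proper_subtubes l h S. Inl l \<in> \<tau>} =
    (\<lambda>j. subbroom l j {}) ` {l<..<h} \<union> subbroom l h ` {S'. S' \<subset> S \<and> (l < h \<or> S' \<noteq> {})}"
proof (rule eq_if_same_subbrooms)
  show "subbroom i j T \<in> {\<tau>\<in>proper_subtubes l h S. Inl l \<in> \<tau>} \<longleftrightarrow>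
      subbroom i j T \<in> (\<lambda>j. subbroom l j {}) ` {l<..<h} \<union>
        subbroom l h ` {S'. S' \<subset> S \<and> (l < h \<or> S' \<noteq> {})}" if "i \<le> j" for i j T
  proof -
    have 1: "subbroom i j T \<in> (\<lambda>j. subbroom l j {}) ` {l<..<h} \<longleftrightarrow> i = l \<and> l < j \<and> j < h \<and> T = {}"
      using that by (auto simp: image_iff subbroom_eq_iff)
    have 2: "subbroom i j T \<in> subbroom l h ` {S'. S' \<subset> S \<and> (l < h \<or> S' \<noteq> {})} \<longleftrightarrow>
        i = l \<and> j = h \<and> T \<subset> S \<and> (l < h \<or> T \<noteq> {})"
      using that by (auto simp: image_iff subbroom_eq_iff)
    have "(l \<le> i \<and> j \<le> h \<and> Q \<and> (j < h \<longrightarrow> P) \<and> (i < j \<or> \<not> P) \<and> \<not> (i = l \<and> j = h \<and> R)) \<and>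
        (i \<le> l \<and> l \<le> j) \<longleftrightarrow>
        (i = l \<and> l < j \<and> j < h \<and> P) \<or> (i = l \<and> j = h \<and> (Q \<and> \<not> R) \<and> (l < h \<or> \<not> P))"
      if "P \<Longrightarrow> Q" for P Q R
      using that \<open>i \<le> j\<close> assms by (cases P; cases Q; cases R; simp) arith+
    from this [of "T = {}" "T \<subseteq> S" "T = S"] show ?thesis
      unfolding Un_iff 1 2 mem_Collect_eq subbroom_in_proper_subtubes_iff [OF that] Inl_in_subbroom
      by (simp add: psubset_eq)
  qed
next
  fix \<tau> assume "\<tau> \<in> (\<lambda>j. subbroom l j {}) ` {l<..<h} \<union>
        subbroom l h ` {S'. S' \<subset> S \<and> (l < h \<or> S' \<noteq> {})}"
  then obtain j T where "l \<le> j" "\<tau> = subbroom l j T"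
    using assms by (elim UnE imageE; metis greaterThanLessThan_iff less_imp_le)
  then show "\<exists>i j T. i \<le> j \<and> \<tau> = subbroom i j T" by blast
qed (blast intro: proper_subtubes_are_subbrooms)

lemma proper_subtubes_below_interval:
  assumes "l < j" "j < h"
  shows "{\<tau>\<in>proper_subtubes l h S. \<tau> \<subset> subbroom l j {}} = proper_subtubes l j {}"
proof (rule eq_if_same_subbrooms)
  show "subbroom a b T \<in> {\<tau>\<in>proper_subtubes l h S. \<tau> \<subset> subbroom l j {}} \<longleftrightarrow>
      subbroom a b T \<in> proper_subtubes l j {}" if "a \<le> b" for a b T
    using that assms
    by (auto simp: subbroom_in_proper_subtubes_iff psubset_eq subbroom_subset_iff subbroom_eq_iff)
qed (blast intro: proper_subtubes_are_subbrooms)+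

lemma proper_subtubes_disjoint_interval:
  assumes "l < j" "j < h"
  shows "{\<tau>\<in>proper_subtubes l h S. \<tau> \<inter> subbroom l j {} = {}} = subtubes (Suc j) h S"
proof (rule eq_if_same_subbrooms)
  show "subbroom a b T \<in> {\<tau>\<in>proper_subtubes l h S. \<tau> \<inter> subbroom l j {} = {}} \<longleftrightarrow>
      subbroom a b T \<in> subtubes (Suc j) h S" if "a \<le> b" for a b T
    using that assms
    by (auto simp: subbroom_in_proper_subtubes_iff subbroom_in_subtubes_iff subbroom_disjoint_iff)
qed (blast intro: proper_subtubes_are_subbrooms subtubes_are_subbrooms)+

lemma proper_subtubes_below_hub:
  assumes "l \<le> h" "S' \<subset> S"
  shows "{\<tau>\<in>proper_subtubes l h S. \<tau> \<subset> subbroom l h S'} = proper_subtubes l h S'"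
proof (rule eq_if_same_subbrooms)
  show "subbroom a b T \<in> {\<tau>\<in>proper_subtubes l h S. \<tau> \<subset> subbroom l h S'} \<longleftrightarrow>
      subbroom a b T \<in> proper_subtubes l h S'" if "a \<le> b" for a b T
    using that assms
    by (auto simp: subbroom_in_proper_subtubes_iff psubset_eq subbroom_subset_iff subbroom_eq_iff)
qed (blast intro: proper_subtubes_are_subbrooms)+

lemma proper_subtubes_disjoint_hub:
  assumes "l \<le> h"
  shows "{\<tau>\<in>proper_subtubes l h S. \<tau> \<inter> subbroom l h S' = {}} = {}"
proof (rule eq_if_same_subbrooms)
  show "subbroom a b T \<in> {\<tau>\<in>proper_subtubes l h S. \<tau> \<inter> subbroom l h S' = {}} \<longleftrightarrow>
      subbroom a b T \<in> {}" if "a \<le> b" for a b T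
    using that assms by (auto simp: subbroom_in_proper_subtubes_iff subbroom_disjoint_iff)
qed (blast intro: proper_subtubes_are_subbrooms)+


text \<open>
  Passing from proper tubes to all tubes gives the factor \<open>1 + 1/x = t/x\<close>, except for the one-element
  broom, which is not a tube of this kind. Both sides are multiplied by \<open>x\<close>.
\<close>
lemma laminar_sum_subtubes:
  assumes "x \<noteq> 0" "l \<le> h" "finite S"
  shows "laminar_sum (1 / x) (subtubes l h S) * x =
    (if l = h \<and> S = {} then x else (x + 1) * laminar_sum (1 / x) (proper_subtubes l h S))"
proof (cases "l = h \<and> S = {}")
  case True
  then show ?thesis by (simp add: subtubes_trivial)
next
  case False
  then have "subbroom l h S \<in> subtubes l h S"
    using assms by (auto simp: subbroom_in_subtubes_iff)
  moreover have "\<forall>\<tau>\<in>subtubes l h S. \<tau> \<subseteq> subbroom l h S"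
  proof
    fix \<tau> assume \<tau>: "\<tau> \<in> subtubes l h S"
    then obtain i j S' where "i \<le> j" "\<tau> = subbroom i j S'"
      by (blast dest: subtubes_are_subbrooms)
    with \<tau> show "\<tau> \<subseteq> subbroom l h S"
      by (simp add: subbroom_in_subtubes_iff subbroom_subset_iff)
  qed
  ultimately have "laminar_sum (1 / x) (subtubes l h S) = (1 + 1 / x) * laminar_sum (1 / x) (proper_subtubes l h S)"
    unfolding proper_subtubes_def using assms by (intro laminar_sum_top finite_subtubes)
  then show ?thesis using False assms(1) by (auto simp: field_simps)
qed

text \<open>
  The three summands belong to the possible largest tubes that contain the bottom element \<open>l\<close>: none, an
  interval ending at \<open>j < h\<close>, or a set reaching the top \<open>h\<close> with some but not all leaves. A tube of the
  last kind contains the whole chain, which every tube meets, so nothing is disjoint from it.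
\<close>
lemma laminar_sum_proper_subtubes_rec:
  assumes "l \<le> h" "finite S"
  shows "laminar_sum y (proper_subtubes l h S) =
    (if l < h then laminar_sum y (subtubes (Suc l) h S) else 1) +
    (\<Sum>j\<in>{l<..<h}. y * laminar_sum y (proper_subtubes l j {}) * laminar_sum y (subtubes (Suc j) h S)) +
    (\<Sum>S'\<in>{S'. S' \<subset> S \<and> (l < h \<or> S' \<noteq> {})}. y * laminar_sum y (proper_subtubes l h S'))"
proof -
  let ?C = "proper_subtubes l h S"
  let ?I = "{S'. S' \<subset> S \<and> (l < h \<or> S' \<noteq> {})}"
  let ?g = "\<lambda>M. y * laminar_sum y {\<tau>\<in>?C. \<tau> \<subset> M} * laminar_sum y {\<tau>\<in>?C. \<tau> \<inter> M = {}}"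
  have fin: "finite ?C" "finite ?I"
    using assms(2) finite_subtubes [of S l h] finite_subset [of ?I "Pow S"] by (auto simp: proper_subtubes_def)
  have ne: "{} \<notin> ?C"
  proof
    assume "{} \<in> ?C"
    then obtain i j S' where "i \<le> j" "{} = subbroom i j S'"
      by (blast dest: proper_subtubes_are_subbrooms)
    then show False by (metis Inl_in_subbroom empty_iff order_refl)
  qed
  have "laminar_sum y ?C = laminar_sum y {\<tau>\<in>?C. Inl l \<notin> \<tau>} + (\<Sum>M\<in>{M\<in>?C. Inl l \<in> M}. ?g M)"
    by (rule laminar_sum_split_point [OF fin(1) ne])
  also have "(\<Sum>M\<in>{M\<in>?C. Inl l \<in> M}. ?g M) =
      (\<Sum>M\<in>(\<lambda>j. subbroom l j {}) ` {l<..<h}. ?g M) + (\<Sum>M\<in>subbroom l h ` ?I. ?g M)"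
    unfolding proper_subtubes_containing_bottom [OF assms(1)]
  proof (rule sum.union_disjoint)
    show "(\<lambda>j. subbroom l j {}) ` {l<..<h} \<inter> subbroom l h ` ?I = {}"
      by (auto simp: subbroom_eq_iff)
  qed (use fin in auto)
  also have "(\<Sum>M\<in>(\<lambda>j. subbroom l j {}) ` {l<..<h}. ?g M) = (\<Sum>j\<in>{l<..<h}. ?g (subbroom l j {}))"
    by (rule sum.reindex_cong [OF _ refl refl]) (auto simp: inj_on_def subbroom_eq_iff)
  also have "\<dots> = (\<Sum>j\<in>{l<..<h}. y * laminar_sum y (proper_subtubes l j {}) * laminar_sum y (subtubes (Suc j) h S))"
    by (rule sum.cong) (simp_all add: proper_subtubes_below_interval proper_subtubes_disjoint_interval)
  also have "(\<Sum>M\<in>subbroom l h ` ?I. ?g M) = (\<Sum>S'\<in>?I. ?g (subbroom l h S'))"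
    using assms(1) by (intro sum.reindex_cong [OF _ refl refl]) (auto simp: inj_on_def subbroom_eq_iff)
  also have "\<dots> = (\<Sum>S'\<in>?I. y * laminar_sum y (proper_subtubes l h S'))"
    using assms(1)
    by (intro sum.cong) (simp_all add: proper_subtubes_below_hub proper_subtubes_disjoint_hub)
  finally show ?thesis
    by (simp add: proper_subtubes_avoiding_bottom add.assoc)
qed

text \<open>
  The recursion of \<open>laminar_sum_proper_subtubes_rec\<close>, scaled by powers of \<open>x\<close>, is
  \<open>broom_h_recurrence\<close> if there are leaves. Without leaves it is the defining recursion of
  \<^const>\<open>broom_h\<close>: there the interval that leaves only the top element of the chain uncovered
  contributes without the factor \<open>t\<close>, because a single element is not a tube.
\<close>
lemma laminar_sum_proper_subtubes_eq_broom_h: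
  assumes "x \<noteq> 0" "l \<le> h" "finite S" "l < h \<or> S \<noteq> {}"
  shows "x ^ (h - l + card S) * laminar_sum (1 / x) (proper_subtubes l h S) =
    x * broom_h (x + 1) (h - l) (card S)"
  using assms
proof (induction "h - l + card S" arbitrary: l h S rule: less_induct)
  case less
  let ?t = "x + 1"
  define P where "P = (\<lambda>l h S. laminar_sum (1 / x) (proper_subtubes l h S))"
  define A where "A = (\<lambda>l h S. laminar_sum (1 / x) (subtubes l h S))"
  define m s where "m = h - l" and "s = card S"
  have IH: "x ^ (h' - l' + card S') * P l' h' S' = x * broom_h ?t (h' - l') (card S')"
    if "h' - l' + card S' < m + s" "l' \<le> h'" "finite S'" "l' < h' \<or> S' \<noteq> {}" for l' h' S'
    using less.hyps [of h' l' S'] that less.prems(1) by (simp add: P_def m_def s_def)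
  \<comment> \<open>The induction hypothesis for families that may contain the whole broom.\<close>
  have IHA: "x ^ (h' - l' + card S') * A l' h' S' =
      (if h' - l' + card S' = 0 then 1 else ?t * broom_h ?t (h' - l') (card S'))"
    if "h' - l' + card S' < m + s" "l' \<le> h'" "finite S'" for l' h' S'
  proof (cases "l' = h' \<and> S' = {}")
    case True
    then show ?thesis by (simp add: A_def subtubes_trivial)
  next
    case False
    then have "x * A l' h' S' = ?t * P l' h' S'"
      using laminar_sum_subtubes [OF less.prems(1) that(2,3)] by (auto simp: A_def P_def mult.commute)
    then have "x * (x ^ (h' - l' + card S') * A l' h' S') = ?t * (x ^ (h' - l' + card S') * P l' h' S')"
      by (metis mult.left_commute)
    also have "\<dots> = x * (?t * broom_h ?t (h' - l') (card S'))"
      using False that by (subst IH) auto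
    finally have "x ^ (h' - l' + card S') * A l' h' S' = ?t * broom_h ?t (h' - l') (card S')"
      using less.prems(1) by simp
    moreover have "h' - l' + card S' \<noteq> 0"
      using False that(2,3) by (cases "l' = h'") simp_all
    ultimately show ?thesis by auto
  qed
  let ?first = "if l < h then A (Suc l) h S else 1"
  let ?second = "\<Sum>j\<in>{l<..<h}. 1 / x * P l j {} * A (Suc j) h S"
  let ?third = "\<Sum>S'\<in>{S'. S' \<subset> S \<and> (l < h \<or> S' \<noteq> {})}. 1 / x * P l h S'"
  have x_eq: "x ^ (m + s) * (1 / x) = x ^ (m + s - 1)" if "m + s > 0"
    using that less.prems(1) by (cases "m + s") auto
  have pos: "m + s > 0"
    using less.prems(2-4) by (cases "l = h") (simp_all add: m_def s_def card_gt_0_iff)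
  have first: "x ^ (m + s) * ?first =
      (if m = 0 then x ^ s else x * (if m - 1 + s = 0 then 1 else ?t * broom_h ?t (m - 1) s))"
  proof (cases "m = 0")
    case True
    then show ?thesis using less.prems by (simp add: m_def)
  next
    case False
    then have "x ^ (m + s) * ?first = x * (x ^ (h - Suc l + card S) * A (Suc l) h S)"
      by (simp add: m_def s_def flip: power_Suc mult.assoc) (simp add: Suc_diff_Suc)
    also have "\<dots> = x * (if m - 1 + s = 0 then 1 else ?t * broom_h ?t (m - 1) s)"
      using False less.prems by (subst IHA) (auto simp: m_def s_def)
    finally show ?thesis using False by simp
  qed
  have "x ^ (m + s) * ?second =
      (\<Sum>j\<in>{l<..<h}. x * broom_h ?t (j - l) 0 *
         (if m - 1 - (j - l) + s = 0 then 1 else ?t * broom_h ?t (m - 1 - (j - l)) s))"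
    unfolding sum_distrib_left
  proof (intro sum.cong refl)
    fix j assume j: "j \<in> {l<..<h}"
    have e: "h - Suc j = m - 1 - (j - l)" "m + s - 1 = (j - l) + (h - Suc j + s)"
      using j by (auto simp: m_def)
    have "x ^ (m + s) * (1 / x * P l j {} * A (Suc j) h S) =
        (x ^ (m + s) * (1 / x)) * P l j {} * A (Suc j) h S"
      by (simp only: mult.assoc)
    also have "\<dots> = (x ^ (j - l + card ({} :: nat set)) * P l j {}) * (x ^ (h - Suc j + card S) * A (Suc j) h S)"
      unfolding x_eq [OF pos] unfolding e(2) by (simp add: power_add s_def)
    also have "\<dots> = x * broom_h ?t (j - l) 0 * (if h - Suc j + s = 0 then 1 else ?t * broom_h ?t (h - Suc j) s)"
    proof -
      have "x ^ (j - l + card ({} :: nat set)) * P l j {} = x * broom_h ?t (j - l) (card ({} :: nat set))"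
        using j by (intro IH) (auto simp: m_def)
      moreover have "x ^ (h - Suc j + card S) * A (Suc j) h S =
          (if h - Suc j + card S = 0 then 1 else ?t * broom_h ?t (h - Suc j) (card S))"
        using j less.prems(3) by (intro IHA) (auto simp: m_def s_def)
      ultimately show ?thesis by (simp only: s_def card.empty)
    qed
    finally show "x ^ (m + s) * (1 / x * P l j {} * A (Suc j) h S) =
        x * broom_h ?t (j - l) 0 * (if m - 1 - (j - l) + s = 0 then 1 else ?t * broom_h ?t (m - 1 - (j - l)) s)"
      unfolding e(1) .
  qed
  also have "\<dots> = (\<Sum>r\<in>{0<..<m}. x * broom_h ?t r 0 *
         (if m - 1 - r + s = 0 then 1 else ?t * broom_h ?t (m - 1 - r) s))"
    by (rule sum.reindex_bij_witness [of _ "\<lambda>r. r + l" "\<lambda>j. j - l"]) (auto simp: m_def)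
  finally have second: "x ^ (m + s) * ?second = \<dots>" .
  have "?third = (\<Sum>S'\<in>Pow S. if card S' = s \<or> m = 0 \<and> card S' = 0 then 0 else 1 / x * P l h S')"
  proof (rule sum.mono_neutral_cong_left)
    show "\<forall>S'\<in>Pow S - {S'. S' \<subset> S \<and> (l < h \<or> S' \<noteq> {})}.
        (if card S' = s \<or> m = 0 \<and> card S' = 0 then 0 else 1 / x * P l h S') = 0"
      using less.prems by (auto simp: s_def m_def)
    fix S' assume "S' \<in> {S'. S' \<subset> S \<and> (l < h \<or> S' \<noteq> {})}"
    then have S': "S' \<subset> S" "l < h \<or> S' \<noteq> {}" by simp_all
    then have "card S' < s" "finite S'"
      using less.prems(3) by (auto simp: s_def psubset_card_mono intro: finite_subset)
    then show "1 / x * P l h S' = (if card S' = s \<or> m = 0 \<and> card S' = 0 then 0 else 1 / x * P l h S')"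
      using S'(2) by (auto simp: m_def)
  qed (use less.prems in auto)
  then have "x ^ (m + s) * ?third =
      (\<Sum>S'\<in>Pow S. x ^ (m + s) * (if card S' = s \<or> m = 0 \<and> card S' = 0 then 0 else 1 / x * P l h S'))"
    by (simp only: sum_distrib_left [symmetric])
  also have "\<dots> =
      (\<Sum>S'\<in>Pow S. if card S' = s \<or> m = 0 \<and> card S' = 0 then 0 else x ^ (s - card S') * broom_h ?t m (card S'))"
  proof (intro sum.cong refl)
    fix S' assume "S' \<in> Pow S"
    then have S': "finite S'" "card S' \<le> s"
      using less.prems(3) by (auto simp: s_def card_mono intro: finite_subset)
    show "x ^ (m + s) * (if card S' = s \<or> m = 0 \<and> card S' = 0 then 0 else 1 / x * P l h S') =
        (if card S' = s \<or> m = 0 \<and> card S' = 0 then 0 else x ^ (s - card S') * broom_h ?t m (card S'))"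
    proof (cases "card S' = s \<or> m = 0 \<and> card S' = 0")
      case False
      have "x * (x ^ (m + s) * (1 / x * P l h S')) = x ^ (m + s) * P l h S'"
        using less.prems(1) by simp
      also have "\<dots> = x ^ (s - card S') * (x ^ (h - l + card S') * P l h S')"
      proof -
        have "m + s = (s - card S') + (h - l + card S')" using S' by (simp add: m_def)
        then show ?thesis by (simp only: power_add mult.assoc)
      qed
      also have "\<dots> = x ^ (s - card S') * (x * broom_h ?t m (card S'))"
        using False S' less.prems(2) by (subst IH) (auto simp: m_def)
      finally show ?thesis using False less.prems(1) by simp
    qed simp
  qed
  also have "\<dots> = (\<Sum>b\<le>s. real (s choose b) * (if b = s \<or> m = 0 \<and> b = 0 then 0 else x ^ (s - b) * broom_h ?t m b))"
    unfolding s_def using less.prems(3) by (rule sum_Pow_by_card)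
  also have "\<dots> = (\<Sum>b<s. real (s choose b) * (if m = 0 \<and> b = 0 then 0 else x ^ (s - b) * broom_h ?t m b))"
    by (simp add: lessThan_Suc_atMost [symmetric])
  finally have third: "x ^ (m + s) * ?third = \<dots>" .
  have "x ^ (m + s) * P l h S = x ^ (m + s) * ?first + x ^ (m + s) * ?second + x ^ (m + s) * ?third"
    using laminar_sum_proper_subtubes_rec [OF less.prems(2,3), of "1 / x"]
    by (simp add: P_def A_def ring_distribs)
  also have "\<dots> =
      (if m = 0 then x ^ s else x * (if m - 1 + s = 0 then 1 else ?t * broom_h ?t (m - 1) s)) +
      (\<Sum>r\<in>{0<..<m}. x * broom_h ?t r 0 * (if m - 1 - r + s = 0 then 1 else ?t * broom_h ?t (m - 1 - r) s)) +
      (\<Sum>b<s. real (s choose b) * (if m = 0 \<and> b = 0 then 0 else x ^ (s - b) * broom_h ?t m b))"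
    by (simp only: first second third)
  also have "\<dots> = x * broom_h ?t m s"
  proof (cases "s = 0")
    case True
    then obtain n where n: "m = Suc n" using pos by (cases m) auto
    show ?thesis
    proof (cases n)
      case 0
      then show ?thesis using True n by (simp add: broom_h.simps(3))
    next
      case (Suc p)
      have "(\<Sum>r\<in>{0<..<m}. x * broom_h ?t r 0 * (if m - 1 - r + s = 0 then 1 else ?t * broom_h ?t (m - 1 - r) s)) =
          (\<Sum>r\<in>{0<..<n}. x * broom_h ?t r 0 * (?t * broom_h ?t (n - r) 0)) + x * broom_h ?t n 0"
      proof -
        have "{0<..<m} = insert n {0<..<n}" using Suc n by auto
        then show ?thesis using n True by (auto intro!: sum.cong)
      qed
      moreover have "(\<Sum>r=1..n. broom_h ?t (n - r) 0 * broom_h ?t r 0) =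
          (\<Sum>r\<in>{0<..<n}. broom_h ?t r 0 * broom_h ?t (n - r) 0) + broom_h ?t n 0"
      proof -
        have "{1..n} = insert n {0<..<n}" using Suc by auto
        then show ?thesis by (simp add: mult.commute)
      qed
      ultimately show ?thesis
        using True n Suc
        by (simp add: broom_h.simps(3) sum_distrib_left algebra_simps)
    qed
  next
    case False
    have rec: "x * broom_h ?t m s = (\<Sum>b<s. real (s choose b) * x ^ (s - b) * broom_h ?t m b) +
        x * ?t * (\<Sum>r<m. broom_h ?t r 0 * broom_h ?t (m - 1 - r) s)"
      using broom_h_recurrence [of s ?t m] False by simp
    show ?thesis
    proof (cases m)
      case 0
      have "{..<s} = insert 0 {0<..<s}" using False by auto
      then show ?thesis using False 0 unfolding rec by (simp add: mult.assoc)
    next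
      case (Suc n)
      then have "{..<m} = insert 0 {0<..<m}" by auto
      then show ?thesis using False Suc unfolding rec
        by (simp add: sum_distrib_left algebra_simps)
    qed
  qed
  finally show ?case by (simp add: P_def m_def s_def)
qed


section \<open>Tubes and tubings of the broom poset\<close>

lemma broom_poset_iff [simp]:
  "(Inl a, Inl b) \<in> broom_poset n k \<longleftrightarrow> a \<le> b \<and> b \<le> n"
  "(Inr c, Inr d) \<in> broom_poset n k \<longleftrightarrow> c = d \<and> c < k"
  "(Inl a, Inr c) \<in> broom_poset n k \<longleftrightarrow> a \<le> n \<and> c < k"
  "(Inr c, Inl a) \<notin> broom_poset n k"
  by (auto simp: broom_poset_def ordinal_sum_def Field_chain_poset Field_antichain_poset)
    (auto simp: chain_poset_def antichain_poset_def)

lemma Field_broom_poset_eq: "Field (broom_poset n k) = subbroom 0 n {..<k}"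
  by (auto simp: Field_broom_poset subbroom_def Plus_def)

lemma covers_broom_poset_iff:
  "(Inl a, Inl b) \<in> covers (broom_poset n k) \<longleftrightarrow> b = Suc a \<and> b \<le> n"
  "(Inl a, Inr c) \<in> covers (broom_poset n k) \<longleftrightarrow> a = n \<and> c < k"
  "(Inr c, z) \<notin> covers (broom_poset n k)"
proof -
  show "(Inl a, Inl b) \<in> covers (broom_poset n k) \<longleftrightarrow> b = Suc a \<and> b \<le> n"
  proof
    assume *: "(Inl a, Inl b) \<in> covers (broom_poset n k)"
    then have ab: "a < b" "b \<le> n" by (auto simp: covers_def)
    with * have "Inl (Suc a) = Inl a \<or> Inl (Suc a) = (Inl b :: nat + nat)"
      unfolding covers_def by (auto elim!: allE [of _ "Inl (Suc a)"])
    with ab show "b = Suc a \<and> b \<le> n" by auto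
  next
    assume ab: "b = Suc a \<and> b \<le> n"
    have "z = Inl a \<or> z = Inl b"
      if "(Inl a, z) \<in> broom_poset n k" "(z, Inl b) \<in> broom_poset n k" for z
      using that ab by (cases z) auto
    then show "(Inl a, Inl b) \<in> covers (broom_poset n k)"
      using ab by (auto simp: covers_def)
  qed
  show "(Inl a, Inr c) \<in> covers (broom_poset n k) \<longleftrightarrow> a = n \<and> c < k"
  proof
    assume *: "(Inl a, Inr c) \<in> covers (broom_poset n k)"
    then have ac: "a \<le> n" "c < k" by (auto simp: covers_def)
    with * have "Inl n = Inl a \<or> Inl n = (Inr c :: nat + nat)"
      unfolding covers_def by (auto elim!: allE [of _ "Inl n"])
    with ac show "a = n \<and> c < k" by auto
  next
    assume ac: "a = n \<and> c < k"
    have "z = Inl a \<or> z = Inr c"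
      if "(Inl a, z) \<in> broom_poset n k" "(z, Inr c) \<in> broom_poset n k" for z
      using that ac by (cases z) auto
    then show "(Inl a, Inr c) \<in> covers (broom_poset n k)"
      using ac by (auto simp: covers_def)
  qed
  show "(Inr c, z) \<notin> covers (broom_poset n k)"
    by (cases z) (auto simp: covers_def)
qed

text \<open>
  A leaf is adjacent only to the top \<open>n\<close> of the chain. Hence a connected set with a leaf and a further
  element contains \<open>n\<close>, and by convexity its chain elements form an interval.
\<close>
lemma tube_broom_poset_iff:
  "tube (broom_poset n k) \<tau> \<and> 1 < card \<tau> \<longleftrightarrow> \<tau> \<in> subtubes 0 n {..<k}"
proof
  assume \<tau>: "\<tau> \<in> subtubes 0 n {..<k}"
  then obtain i j S where t: "\<tau> = subbroom i j S" "i \<le> j" "j \<le> n" "S \<subseteq> {..<k}"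
    "j < n \<longrightarrow> S = {}" "i < j \<or> S \<noteq> {}"
    by (auto simp: subtubes_def)
  let ?R = "hasse_diagram (broom_poset n k) \<inter> \<tau> \<times> \<tau>"
  have down: "(Inl (j - d), Inl j) \<in> ?R\<^sup>*" if "i \<le> j - d" for d
    using that
  proof (induction d)
    case (Suc d)
    show ?case
    proof (cases "j \<le> d")
      case False
      then have "(Inl (j - Suc d), Inl (j - d)) \<in> ?R"
        using Suc.prems t by (auto simp: hasse_diagram_def covers_broom_poset_iff)
      moreover have "(Inl (j - d), Inl j) \<in> ?R\<^sup>*"
        using Suc by auto
      ultimately show ?thesis by (rule converse_rtrancl_into_rtrancl)
    qed (use Suc in auto)
  qed simp
  have leaf: "(Inr c, Inl j) \<in> ?R" if "c \<in> S" for c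
    using that t by (auto simp: hasse_diagram_def covers_broom_poset_iff)
  have to_hub: "(z, Inl j) \<in> ?R\<^sup>*" if "z \<in> \<tau>" for z
  proof (cases z)
    case (Inl a)
    then show ?thesis using that t down [of "j - a"] by auto
  next
    case (Inr c)
    then show ?thesis using that t leaf [of c] by auto
  qed
  have "sym ?R" by (auto simp: sym_def hasse_diagram_def)
  then have "(x, y) \<in> ?R\<^sup>*" if "x \<in> \<tau>" "y \<in> \<tau>" for x y
    using to_hub [OF that(1)] to_hub [OF that(2)] by (meson rtrancl_trans symD sym_rtrancl)
  then have "hasse_connected (broom_poset n k) \<tau>"
    by (simp add: hasse_connected_def)
  moreover have "order_convex (broom_poset n k) \<tau>"
    unfolding order_convex_def
  proof (intro ballI impI)
    fix x z y
    assume "x \<in> \<tau>" "z \<in> \<tau>" "y \<in> Field (broom_poset n k)"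
      "(x, y) \<in> broom_poset n k \<and> (y, z) \<in> broom_poset n k"
    then show "y \<in> \<tau>" using t by (cases x; cases y; cases z) auto
  qed
  moreover have "\<tau> \<subseteq> Field (broom_poset n k)"
    using t by (simp add: Field_broom_poset_eq subbroom_subset_iff)
  moreover have "1 < card \<tau>"
  proof -
    have fin: "finite \<tau>"
      using t finite_subset [OF t(4)] by (simp add: subbroom_def)
    obtain z where "z \<in> \<tau>" "z \<noteq> Inl i"
    proof (cases "i < j")
      case True
      then show ?thesis using that [of "Inl j"] t by auto
    next
      case False
      then obtain c where "c \<in> S" using t by auto
      then show ?thesis using that [of "Inr c"] t by auto
    qed
    then have "card {Inl i, z} \<le> card \<tau>"
      using fin t by (intro card_mono) auto
    then show ?thesis using \<open>z \<noteq> Inl i\<close> by auto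
  qed
  ultimately show "tube (broom_poset n k) \<tau> \<and> 1 < card \<tau>"
    by (simp add: tube_def)
next
  assume *: "tube (broom_poset n k) \<tau> \<and> 1 < card \<tau>"
  then have sub: "\<tau> \<subseteq> subbroom 0 n {..<k}" and conn: "hasse_connected (broom_poset n k) \<tau>"
    and convex: "order_convex (broom_poset n k) \<tau>" and "1 < card \<tau>"
    by (auto simp: tube_def Field_broom_poset_eq)
  define A S where "A = {a. Inl a \<in> \<tau>}" and "S = {c. Inr c \<in> \<tau>}"
  have A: "A \<subseteq> {..n}" using sub by (auto simp: A_def)
  have S: "S \<subseteq> {..<k}" using sub by (auto simp: S_def)
  \<comment> \<open>The first step of a path from a leaf to any other element of the tube leads to \<open>n\<close>.\<close>
  have hub: "n \<in> A" if "c \<in> S" for c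
  proof -
    have "\<tau> \<noteq> {Inr c}" using \<open>1 < card \<tau>\<close> by auto
    moreover have c: "Inr c \<in> \<tau>" using that by (simp add: S_def)
    ultimately obtain z where "z \<in> \<tau>" "z \<noteq> Inr c" by blast
    then have "(Inr c, z) \<in> (hasse_diagram (broom_poset n k) \<inter> \<tau> \<times> \<tau>)\<^sup>*"
      using conn c by (auto simp: hasse_connected_def)
    then obtain y where "(Inr c, y) \<in> hasse_diagram (broom_poset n k)" "y \<in> \<tau>"
      using \<open>z \<noteq> Inr c\<close> by (auto elim: converse_rtranclE)
    then show "n \<in> A"
      by (cases y) (auto simp: hasse_diagram_def covers_broom_poset_iff A_def)
  qed
  have "A \<noteq> {}"
  proof
    assume "A = {}"
    then have "S = {}" using hub by auto
    have "z \<notin> \<tau>" for z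
      using \<open>A = {}\<close> \<open>S = {}\<close> by (cases z) (auto simp: A_def S_def)
    then have "\<tau> = {}" by blast
    then show False using \<open>1 < card \<tau>\<close> by simp
  qed
  moreover have "finite A" using A by (rule finite_subset) simp
  define i j where "i = Min A" and "j = Max A"
  ultimately have ij: "i \<in> A" "j \<in> A" "\<And>a. a \<in> A \<Longrightarrow> i \<le> a \<and> a \<le> j"
    using \<open>finite A\<close> by (auto simp: i_def j_def)
  have fill: "a \<in> A" if "i \<le> a" "a \<le> j" for a
  proof -
    have "Inl i \<in> \<tau>" "Inl j \<in> \<tau>" using ij by (auto simp: A_def)
    moreover have "j \<le> n" using A ij by auto
    then have "(Inl i, Inl a) \<in> broom_poset n k \<and> (Inl a, Inl j) \<in> broom_poset n k"
      "Inl a \<in> Field (broom_poset n k)"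
      using that by (simp_all add: Field_broom_poset_eq)
    ultimately have "Inl a \<in> \<tau>"
      using convex unfolding order_convex_def by blast
    then show ?thesis by (simp add: A_def)
  qed
  have A_eq: "A = {i..j}"
  proof
    show "A \<subseteq> {i..j}" using ij(3) by (intro subsetI) simp
    show "{i..j} \<subseteq> A" by (intro subsetI fill) simp_all
  qed
  have "z \<in> \<tau> \<longleftrightarrow> z \<in> subbroom i j S" for z
  proof (cases z)
    case (Inl a)
    have "a \<in> A \<longleftrightarrow> i \<le> a \<and> a \<le> j" by (simp add: A_eq)
    then show ?thesis by (simp add: Inl A_def)
  qed (simp add: S_def)
  then have \<tau>: "\<tau> = subbroom i j S" by blast
  have "i \<le> j" "j \<le> n" using ij A by auto
  moreover have "S = {}" if "j < n" using hub ij(3) that by force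
  moreover have "i < j \<or> S \<noteq> {}"
  proof (rule ccontr)
    assume "\<not> (i < j \<or> S \<noteq> {})"
    then have "\<tau> = {Inl i}" using \<open>i \<le> j\<close> by (auto simp: \<tau> subbroom_def)
    then show False using \<open>1 < card \<tau>\<close> by simp
  qed
  ultimately show "\<tau> \<in> subtubes 0 n {..<k}"
    using S by (auto simp: \<tau> subbroom_in_subtubes_iff)
qed

lemma proper_tube_broom_poset_iff:
  "proper_tube (broom_poset n k) \<tau> \<longleftrightarrow> \<tau> \<in> proper_subtubes 0 n {..<k}"
proof -
  have "card \<tau> < card (Field (broom_poset n k)) \<longleftrightarrow> \<tau> \<noteq> Field (broom_poset n k)"
    if "\<tau> \<subseteq> Field (broom_poset n k)"
  proof -
    have "finite (Field (broom_poset n k))" by (simp add: Field_broom_poset)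
    then show ?thesis using that by (metis card_subset_eq card_mono le_neq_implies_less less_irrefl)
  qed
  then show ?thesis
    using tube_broom_poset_iff [of n k \<tau>]
    by (auto simp: proper_tube_def proper_subtubes_def tube_def Field_broom_poset_eq)
qed

text \<open>
  If \<open>\<sigma> \<prec> \<tau>\<close> holds for tubes of this kind then \<open>\<sigma>\<close> has the smaller lowest chain element. So the relation
  \<open>\<prec>\<close> has no cycles.
\<close>
lemma tubing_broom_poset_iff:
  "tubing (broom_poset n k) T \<longleftrightarrow> T \<in> laminar_families (proper_subtubes 0 n {..<k})"
proof -
  have "acyclic {(\<sigma>, \<tau>). \<sigma> \<in> T \<and> \<tau> \<in> T \<and> tube_prec (broom_poset n k) \<sigma> \<tau>}"
    if T: "T \<subseteq> proper_subtubes 0 n {..<k}"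
  proof (rule wf_acyclic, rule wf_subset)
    \<comment> \<open>The lowest chain element is strictly increasing along \<open>\<prec>\<close>.\<close>
    define lo where "lo = (\<lambda>\<tau> :: (nat + nat) set. LEAST a. Inl a \<in> \<tau>)"
    have lo: "lo (subbroom i j S) = i" if "i \<le> j" for i j S
      using that unfolding lo_def by (intro Least_equality) auto
    show "wf (Wellfounded.measure lo)" by simp
    show "{(\<sigma>, \<tau>). \<sigma> \<in> T \<and> \<tau> \<in> T \<and> tube_prec (broom_poset n k) \<sigma> \<tau>} \<subseteq> Wellfounded.measure lo"
    proof clarify
      fix \<sigma> \<tau> assume "\<sigma> \<in> T" "\<tau> \<in> T" and prec: "tube_prec (broom_poset n k) \<sigma> \<tau>"
      with T have st: "\<sigma> \<in> subtubes 0 n {..<k}" "\<tau> \<in> subtubes 0 n {..<k}"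
        by (auto simp: proper_subtubes_def)
      obtain i j S where \<sigma>: "\<sigma> = subbroom i j S" "i \<le> j" "j \<le> n" "j < n \<longrightarrow> S = {}"
        using st(1) by (auto simp: subtubes_def)
      obtain i' j' S' where \<tau>: "\<tau> = subbroom i' j' S'" "i' \<le> j'" "j' \<le> n" "j' < n \<longrightarrow> S' = {}"
        using st(2) by (auto simp: subtubes_def)
      have disj: "(j < i' \<or> j' < i) \<and> S \<inter> S' = {}"
        using prec \<sigma> \<tau> by (auto simp: tube_prec_def subbroom_disjoint_iff)
      obtain x y where xy: "x \<in> \<sigma>" "y \<in> \<tau>" "(x, y) \<in> broom_poset n k"
        using prec by (auto simp: tube_prec_def)
      have "\<not> j' < i"
        using xy \<sigma> \<tau> disj by (cases x; cases y) auto
      then have "i < i'" using disj \<sigma>(2) by auto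
      then show "(\<sigma>, \<tau>) \<in> Wellfounded.measure lo"
        using \<sigma> \<tau> by (simp add: lo)
    qed
  qed
  then show ?thesis
    by (auto simp: tubing_def proper_tube_broom_poset_iff laminar_families_def subset_iff)
qed


section \<open>Faces and the h-polynomial\<close>

text \<open>
  The face of a tubing \<open>T\<close> is nonempty of dimension \<open>d - |T|\<close>. In particular \<open>|T| \<le> d\<close>, so the truncated
  subtraction in the exponent is harmless.
\<close>
lemma poly_f_polynomial:
  fixes Q :: "'e::euclidean_space set"
  assumes "poset_associahedron r Q"
  shows "finite {T. tubing r T}"
    and "tubing r T \<Longrightarrow> int (card T) \<le> aff_dim Q"
    and "poly (f_polynomial Q) z = (\<Sum>T\<in>{T. tubing r T}. z ^ (nat (aff_dim Q) - card T))"
proof -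
  let ?T = "{T. tubing r T}" and ?F = "{F. F face_of Q \<and> F \<noteq> {}}"
  define d where "d = nat (aff_dim Q)"
  obtain \<phi> where \<phi>: "bij_betw \<phi> ?T ?F"
    and dim': "\<And>T. tubing r T \<Longrightarrow> aff_dim (\<phi> T) = int (card (Field r)) - 2 - int (card T)"
    and aff: "aff_dim Q = int (card (Field r)) - 2" and "polytope Q"
    using assms by (auto simp: poset_associahedron_def simple_polytope_def)
  have "finite {F. F face_of Q}"
    using \<open>polytope Q\<close> by (simp add: finite_polytope_faces)
  then have "finite ?F" by (rule rev_finite_subset) auto
  then show fin: "finite ?T" using bij_betw_finite [OF \<phi>] by simp
  have dim: "aff_dim (\<phi> T) = aff_dim Q - int (card T)" if "tubing r T" for T
    using dim' [OF that] aff by simp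
  have le: "int (card T) \<le> aff_dim Q" if "tubing r T" for T
  proof -
    have "\<phi> T \<noteq> {}" using bij_betwE [OF \<phi>] that by auto
    then have "aff_dim (\<phi> T) \<ge> 0" by (metis aff_dim_empty aff_dim_negative_iff linorder_not_less)
    then show ?thesis using dim [OF that] by simp
  qed
  then show "tubing r T \<Longrightarrow> int (card T) \<le> aff_dim Q" .
  have card_d: "card T \<le> d" "aff_dim (\<phi> T) = int (d - card T)" if "tubing r T" for T
    using le [OF that] dim [OF that] by (auto simp: d_def)
  have "card {F. F face_of Q \<and> aff_dim F = int i} = card {T \<in> ?T. d - card T = i}" for i
  proof -
    have "\<phi> ` {T \<in> ?T. d - card T = i} = {F. F face_of Q \<and> aff_dim F = int i}" (is "?l = ?r")
    proof
      show "?l \<subseteq> ?r"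
      proof
        fix F assume "F \<in> ?l"
        then obtain T where T: "F = \<phi> T" "tubing r T" "d - card T = i" by blast
        then have "F \<in> ?F" using bij_betwE [OF \<phi>] by blast
        then show "F \<in> ?r" using card_d(2) [OF T(2)] T by simp
      qed
      show "?r \<subseteq> ?l"
      proof
        fix F assume F: "F \<in> ?r"
        then have "F \<in> ?F" by auto
        then obtain T where "F = \<phi> T" "tubing r T"
          using \<phi> by (auto simp: bij_betw_def)
        moreover have "int (d - card T) = int i"
          using card_d(2) [OF \<open>tubing r T\<close>] F \<open>F = \<phi> T\<close> by simp
        ultimately show "F \<in> ?l" by (intro image_eqI) simp_all
      qed
    qed
    moreover have "inj_on \<phi> {T \<in> ?T. d - card T = i}"
      by (rule inj_on_subset [OF bij_betw_imp_inj_on [OF \<phi>]]) blast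
    then have "card (\<phi> ` {T \<in> ?T. d - card T = i}) = card {T \<in> ?T. d - card T = i}"
      by (rule card_image)
    ultimately show ?thesis by (simp only:)
  qed
  then have "poly (f_polynomial Q) z = (\<Sum>i\<le>d. int (card {T \<in> ?T. d - card T = i}) * z ^ i)"
    by (simp add: f_polynomial_def poly_sum poly_monom d_def)
  also have "\<dots> = (\<Sum>i\<le>d. \<Sum>T\<in>{T \<in> ?T. d - card T = i}. z ^ (d - card T))"
    by (intro sum.cong) auto
  also have "\<dots> = (\<Sum>T\<in>?T. z ^ (d - card T))"
    using fin by (intro sum.group) auto
  finally show "poly (f_polynomial Q) z = (\<Sum>T\<in>?T. z ^ (nat (aff_dim Q) - card T))"
    by (simp add: d_def)
qed

lemma poly_eq_if_eq_above:
  fixes p q :: "int poly"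
  assumes "\<And>z. z \<ge> 2 \<Longrightarrow> poly p z = poly q z"
  shows "p = q"
proof (rule ccontr)
  assume "p \<noteq> q"
  then have "finite {z. poly (p - q) z = 0}" by (intro poly_roots_finite) simp
  moreover have "{2..} \<subseteq> {z. poly (p - q) z = 0}" using assms by auto
  ultimately have "finite {2 :: int..}" by (rule rev_finite_subset)
  then show False by (simp add: infinite_Ici)
qed

text \<open>
  Comparing integer values \<open>z \<ge> 2\<close> ensures \<open>x = z - 1 \<noteq> 0\<close>, which is needed because the tubing sum is
  expressed by powers of \<open>1/x\<close>.
\<close>
lemma h_polynomial_broom_associahedron:
  fixes Q :: "'e::euclidean_space set"
  assumes "n + k \<ge> 1" and Q: "poset_associahedron (broom_poset n k) Q"
  shows "h_polynomial Q =
    (\<Sum>w\<in>stack_sort_preimage (n + k) (perms_fixing_above n k). monom 1 (num_descents w))"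
proof (rule poly_eq_if_eq_above)
  fix z :: int assume z: "z \<ge> 2"
  let ?T = "{T. tubing (broom_poset n k) T}" and ?d = "n + k - 1"
  define x where "x = real_of_int (z - 1)"
  have "x \<noteq> 0" using z by (simp add: x_def)
  have aff: "aff_dim Q = int ?d"
    using Q assms(1) by (simp add: poset_associahedron_def card_Field_broom_poset)
  have "real_of_int (poly (h_polynomial Q) z) = (\<Sum>T\<in>?T. x ^ (?d - card T))"
    using poly_f_polynomial(3) [OF Q] by (simp add: h_polynomial_def poly_pcompose aff x_def)
  also have "\<dots> = (\<Sum>T\<in>?T. x ^ ?d * (1 / x) ^ card T)"
  proof (intro sum.cong refl)
    fix T assume "T \<in> ?T"
    then have "card T \<le> ?d" using poly_f_polynomial(2) [OF Q] aff by force
    then have "x ^ ?d = x ^ (?d - card T) * x ^ card T"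
      by (metis le_add_diff_inverse2 power_add)
    then show "x ^ (?d - card T) = x ^ ?d * (1 / x) ^ card T"
      using \<open>x \<noteq> 0\<close> by (simp add: power_one_over)
  qed
  also have "\<dots> = x ^ ?d * laminar_sum (1 / x) (proper_subtubes 0 n {..<k})"
    by (simp add: laminar_sum_def tubing_broom_poset_iff sum_distrib_left)
  also have "\<dots> = broom_h (x + 1) n k"
  proof -
    have "n - 0 + card {..<k} = Suc ?d" using assms(1) by simp
    then have "x * (x ^ ?d * laminar_sum (1 / x) (proper_subtubes 0 n {..<k})) =
        x ^ (n - 0 + card {..<k}) * laminar_sum (1 / x) (proper_subtubes 0 n {..<k})"
      by (simp only: power_Suc mult.assoc)
    also have "\<dots> = x * broom_h (x + 1) (n - 0) (card {..<k})"
      using assms(1) \<open>x \<noteq> 0\<close> by (intro laminar_sum_proper_subtubes_eq_broom_h) (auto simp: lessThan_empty_iff)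
    finally show ?thesis using \<open>x \<noteq> 0\<close> by simp
  qed
  also have "\<dots> = (\<Sum>w\<in>stack_sort_preimage (n + k) (perms_fixing_above n k). real_of_int z ^ num_descents w)"
    by (simp add: descent_sum_eq_broom_h x_def)
  finally have "real_of_int (poly (h_polynomial Q) z) = \<dots>" .
  then have "real_of_int (poly (h_polynomial Q) z) =
      real_of_int (\<Sum>w\<in>stack_sort_preimage (n + k) (perms_fixing_above n k). z ^ num_descents w)"
    by simp
  then show "poly (h_polynomial Q) z =
      poly (\<Sum>w\<in>stack_sort_preimage (n + k) (perms_fixing_above n k). monom 1 (num_descents w)) z"
    unfolding of_int_eq_iff by (simp add: poly_sum poly_monom)
qed

theorem theorem4p8:
  fixes n k i :: nat and Q :: "'e::euclidean_space set"
  assumes "n + k \<ge> 1"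
    and "poset_associahedron (broom_poset n k) Q"
    and "i \<le> n + k - 1"
  shows "h_vector Q i =
    int (card {w \<in> stack_sort_preimage (n + k) (perms_fixing_above n k). num_descents w = i})"
proof -
  have "finite (stack_sort_preimage (n + k) (perms_fixing_above n k))"
    by (simp add: stack_sort_preimage_def)
  then show ?thesis
    unfolding h_vector_def h_polynomial_broom_associahedron [OF assms(1,2)]
    by (simp add: coeff_sum sum.If_cases Int_def)
qed

end
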